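(* Let $\Gamma$ be a group generated by a finite set $X$. Then $\Gamma$ has solvable generic Word Problem with respect to $X$ if and only if it has solvable generic Equality Problem with respect to $X$. Moreover, the Word Problem of $\Gamma$ is solvable only on negligible subsets of $\mathbb F_X$ if and only if the Equality Problem of $\Gamma$ is solvable only on negligible subsets of $\mathbb F_X^2$.
   Context: $\mathbb F_X$ is the free group on $X$, $\pi:\mathbb F_X\to\Gamma$ the canonical epimorphism, $|\omega|$ the reduced word length. On $\mathbb F_X^k$ use the length $|(\omega_1,\dots,\omega_k)|=|\omega_1|+\dots+|\omega_k|$ and let $B_n(\mathbb F_X^k)$ be the ball of radius $n$ about the identity for this length. A set $S\subset\mathbb F_X^k$ is negligible if $\lim_{n\to\infty}|S\cap B_n(\mathbb F_X^k)|/|B_n(\mathbb F_X^k)|=0$ and generic if its complement is negligible. $\Gamma$ has solvable Word Problem on $S\subset\mathbb F_X$ if there is a partial algorithm halting at least on every $\omega\in S$ and, whenever it halts, correctly deciding whether $\pi(\omega)$ is trivial; it has solvable generic Word Problem with respect to $X$ if this holds for some generic $S\subset\mathbb F_X$. $\Gamma$ has solvable Equality Problem on $T\subset\mathbb F_X^2$ if there is a partial algorithm halting at least on every $(\omega_1,\omega_2)\in T$ and, whenever it halts, correctly deciding whether $\pi(\omega_1)=\pi(\omega_2)$; it has solvable generic Equality Problem with respect to $X$ if this holds for some generic $T\subset\mathbb F_X^2$. *)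

theory Defs
  imports Complex_Main "HOL-Algebra.Generated_Groups" "HOL-Library.Nat_Bijection"
begin

datatype recf = Zf | Sf | Idf nat | Cnf recf "recf list" | Prf recf recf | Mnf recf

inductive eval :: "recf \<Rightarrow> nat list \<Rightarrow> nat \<Rightarrow> bool" where
  zero: "eval Zf xs 0"
| succ: "eval Sf (x # xs) (Suc x)"
| proj: "i < length xs \<Longrightarrow> eval (Idf i) xs (xs ! i)"
| comp: "length ys = length gs \<Longrightarrow> (\<forall>i < length gs. eval (gs ! i) xs (ys ! i))
          \<Longrightarrow> eval f ys r \<Longrightarrow> eval (Cnf f gs) xs r"
| prim0: "eval f xs r \<Longrightarrow> eval (Prf f g) (0 # xs) r"
| primS: "eval (Prf f g) (n # xs) r \<Longrightarrow> eval g (n # r # xs) r'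
          \<Longrightarrow> eval (Prf f g) (Suc n # xs) r'"
| mu: "eval f (n # xs) 0 \<Longrightarrow> (\<forall>m < n. \<exists>r. eval f (m # xs) r \<and> r \<noteq> 0)
          \<Longrightarrow> eval (Mnf f) xs n"

text \<open>A letter (i, True) stands for x_i, (i, False) for x_i^{-1}.\<close>
type_synonym word = "(nat \<times> bool) list"

fun reduced :: "word \<Rightarrow> bool" where
  "reduced (a # b # w) = (\<not> (fst a = fst b \<and> snd a \<noteq> snd b) \<and> reduced (b # w))"
| "reduced _ = True"

definition FX :: "nat \<Rightarrow> word set" where
  "FX k = {w. reduced w \<and> (\<forall>a \<in> set w. fst a < k)}"

definition ball1 :: "nat \<Rightarrow> nat \<Rightarrow> word set" where
  "ball1 k n = {w \<in> FX k. length w \<le> n}"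

definition ball2 :: "nat \<Rightarrow> nat \<Rightarrow> (word \<times> word) set" where
  "ball2 k n = {(u, v). u \<in> FX k \<and> v \<in> FX k \<and> length u + length v \<le> n}"

definition negligible1 :: "nat \<Rightarrow> word set \<Rightarrow> bool" where
  "negligible1 k S \<longleftrightarrow>
     (\<lambda>n. real (card (S \<inter> ball1 k n)) / real (card (ball1 k n))) \<longlonglongrightarrow> 0"

definition negligible2 :: "nat \<Rightarrow> (word \<times> word) set \<Rightarrow> bool" where
  "negligible2 k T \<longleftrightarrow>
     (\<lambda>n. real (card (T \<inter> ball2 k n)) / real (card (ball2 k n))) \<longlonglongrightarrow> 0"

definition generic1 :: "nat \<Rightarrow> word set \<Rightarrow> bool" where
  "generic1 k S \<longleftrightarrow> negligible1 k (FX k - S)"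

definition generic2 :: "nat \<Rightarrow> (word \<times> word) set \<Rightarrow> bool" where
  "generic2 k T \<longleftrightarrow> negligible2 k ({(u, v). u \<in> FX k \<and> v \<in> FX k} - T)"

definition piG :: "('a, 'b) monoid_scheme \<Rightarrow> (nat \<Rightarrow> 'a) \<Rightarrow> word \<Rightarrow> 'a" where
  "piG G g w = foldr (\<lambda>a acc. (if snd a then g (fst a) else inv\<^bsub>G\<^esub> (g (fst a))) \<otimes>\<^bsub>G\<^esub> acc) w \<one>\<^bsub>G\<^esub>"

definition code :: "word \<Rightarrow> nat" where
  "code w = list_encode (map (\<lambda>a. prod_encode (fst a, if snd a then 1 else 0)) w)"

definition WP_solvable_on :: "('a, 'b) monoid_scheme \<Rightarrow> (nat \<Rightarrow> 'a) \<Rightarrow> nat \<Rightarrow> word set \<Rightarrow> bool" where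
  "WP_solvable_on G g k S \<longleftrightarrow> (\<exists>f.
     (\<forall>w \<in> S. \<exists>r. eval f [code w] r) \<and>
     (\<forall>w \<in> FX k. \<forall>r. eval f [code w] r \<longrightarrow>
         (r = 0 \<or> r = 1) \<and> (r = 1 \<longleftrightarrow> piG G g w = \<one>\<^bsub>G\<^esub>)))"

definition EP_solvable_on :: "('a, 'b) monoid_scheme \<Rightarrow> (nat \<Rightarrow> 'a) \<Rightarrow> nat \<Rightarrow> (word \<times> word) set \<Rightarrow> bool" where
  "EP_solvable_on G g k T \<longleftrightarrow> (\<exists>f.
     (\<forall>(u, v) \<in> T. \<exists>r. eval f [code u, code v] r) \<and>
     (\<forall>u \<in> FX k. \<forall>v \<in> FX k. \<forall>r. eval f [code u, code v] r \<longrightarrow>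
         (r = 0 \<or> r = 1) \<and> (r = 1 \<longleftrightarrow> piG G g u = piG G g v)))"

definition generic_WP :: "('a, 'b) monoid_scheme \<Rightarrow> (nat \<Rightarrow> 'a) \<Rightarrow> nat \<Rightarrow> bool" where
  "generic_WP G g k \<longleftrightarrow> (\<exists>S \<subseteq> FX k. generic1 k S \<and> WP_solvable_on G g k S)"

definition generic_EP :: "('a, 'b) monoid_scheme \<Rightarrow> (nat \<Rightarrow> 'a) \<Rightarrow> nat \<Rightarrow> bool" where
  "generic_EP G g k \<longleftrightarrow> (\<exists>T \<subseteq> {(u, v). u \<in> FX k \<and> v \<in> FX k}. generic2 k T \<and> EP_solvable_on G g k T)"

definition WP_only_negligible :: "('a, 'b) monoid_scheme \<Rightarrow> (nat \<Rightarrow> 'a) \<Rightarrow> nat \<Rightarrow> bool" where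
  "WP_only_negligible G g k \<longleftrightarrow> (\<forall>S \<subseteq> FX k. WP_solvable_on G g k S \<longrightarrow> negligible1 k S)"

definition EP_only_negligible :: "('a, 'b) monoid_scheme \<Rightarrow> (nat \<Rightarrow> 'a) \<Rightarrow> nat \<Rightarrow> bool" where
  "EP_only_negligible G g k \<longleftrightarrow>
     (\<forall>T \<subseteq> {(u, v). u \<in> FX k \<and> v \<in> FX k}. EP_solvable_on G g k T \<longrightarrow> negligible2 k T)"

end

theory Submission
  imports Defs
begin

text \<open>The map sending \<open>(u, v)\<close> to the reduced form of \<open>u\<^sup>-\<^sup>1 v\<close> relates the two problems, as
  \<open>\<pi>(u) = \<pi>(v)\<close> iff its value lies in the kernel of \<open>\<pi>\<close>. It transports solvability in both
  directions: from words to pairs by composition, and from pairs to words by a dovetailed search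
  through the fibre. It also preserves and reflects negligibility. A word of length \<open>l\<close> has at
  least \<open>l + 1\<close> preimages, namely its splittings into two subwords, and at most \<open>l + 1\<close> times as many
  preimages in the ball of radius \<open>n\<close> as there are words of length at most \<open>(n - l) / 2\<close> (these are
  the possible common prefixes of \<open>u\<close> and \<open>v\<close>), while the ball of radius \<open>n\<close> in the square is of
  size about \<open>n\<close> times that of the ball in the free group. When balls grow exponentially, this makes
  the preimages of short words negligible; in rank one it suffices that \<open>u\<close> and the quotient
  determine \<open>v\<close>.\<close>

subsection \<open>Total recursive functions\<close>

text \<open>Values of \<open>F\<close> on lists of other lengths are left open, so \<open>F\<close>
  may be written freely with \<open>!\<close> and \<open>drop\<close>.\<close>

definition computable :: "nat \<Rightarrow> (nat list \<Rightarrow> nat) \<Rightarrow> bool" where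
  "computable n F \<longleftrightarrow> (\<exists>f. \<forall>xs. length xs = n \<longrightarrow> eval f xs (F xs))"

lemma computable_cong:
  assumes "computable n F" "\<And>xs. length xs = n \<Longrightarrow> F xs = F' xs"
  shows "computable n F'"
  using assms unfolding computable_def by metis

lemma computable_zero: "computable n (\<lambda>xs. 0)"
  unfolding computable_def using eval.zero by blast

lemma computable_nth: "i < n \<Longrightarrow> computable n (\<lambda>xs. xs ! i)"
  unfolding computable_def by (metis eval.proj)

lemma computable_comp:
  assumes F: "computable (length Gs) F" and Gs: "\<And>G. G \<in> set Gs \<Longrightarrow> computable n G"
  shows "computable n (\<lambda>xs. F (map (\<lambda>G. G xs) Gs))"
proof -
  obtain f where f: "\<And>xs. length xs = length Gs \<Longrightarrow> eval f xs (F xs)"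
    using F unfolding computable_def by auto
  have "\<forall>G\<in>set Gs. \<exists>g. \<forall>xs. length xs = n \<longrightarrow> eval g xs (G xs)"
    using Gs unfolding computable_def by auto
  then obtain g where g: "\<And>G xs. G \<in> set Gs \<Longrightarrow> length xs = n \<Longrightarrow> eval (g G) xs (G xs)"
    by metis
  have "eval (Cnf f (map g Gs)) xs (F (map (\<lambda>G. G xs) Gs))" if "length xs = n" for xs
    by (rule eval.comp[where ys = "map (\<lambda>G. G xs) Gs"]) (use that f g in auto)
  then show ?thesis
    unfolding computable_def by blast
qed

lemma computable_comp1:
  assumes "computable 1 (\<lambda>xs. h (xs ! 0))" "computable n A"
  shows "computable n (\<lambda>xs. h (A xs))"
  using computable_comp[of "[A]" "\<lambda>xs. h (xs ! 0)" n] assms by simp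

lemma computable_Suc:
  assumes "computable n A"
  shows "computable n (\<lambda>xs. Suc (A xs))"
proof -
  have "eval Sf xs (Suc (xs ! 0))" if "length xs = 1" for xs
    using that eval.succ by (cases xs) auto
  then have "computable 1 (\<lambda>xs. Suc (xs ! 0))"
    unfolding computable_def by blast
  from computable_comp1[OF this assms] show ?thesis .
qed

lemma computable_const: "computable n (\<lambda>xs. c)"
  by (induction c) (auto intro: computable_zero computable_Suc)

text \<open>Tuple-valued functions allow composition with an argument list given as a term, such as
  \<open>A xs # B xs\<close>, instead of a list of coordinate functions.\<close>

definition computables :: "nat \<Rightarrow> nat \<Rightarrow> (nat list \<Rightarrow> nat list) \<Rightarrow> bool" where
  "computables n m A \<longleftrightarrow> (\<forall>xs. length xs = n \<longrightarrow> length (A xs) = m) \<and>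
     (\<forall>i<m. computable n (\<lambda>xs. A xs ! i))"

lemma computables_id: "computables n n (\<lambda>xs. xs)"
  by (simp add: computables_def computable_nth)

lemma computables_Cons:
  assumes "computable n A" "computables n m B"
  shows "computables n (Suc m) (\<lambda>xs. A xs # B xs)"
proof -
  have "computable n (\<lambda>xs. (A xs # B xs) ! i)" if "i < Suc m" for i
    using assms that by (cases i) (auto simp: computables_def)
  then show ?thesis using assms by (simp add: computables_def)
qed

lemma computables_drop:
  assumes "computables n (d + m) A"
  shows "computables n m (\<lambda>xs. drop d (A xs))"
proof -
  have "computable n (\<lambda>xs. drop d (A xs) ! i)" if "i < m" for i
  proof (rule computable_cong)
    show "computable n (\<lambda>xs. A xs ! (d + i))"
      using assms that by (simp add: computables_def)
  qed (use assms in \<open>simp add: computables_def\<close>)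
  then show ?thesis using assms by (simp add: computables_def)
qed

lemma computables_map:
  assumes "\<And>g. g \<in> set gs \<Longrightarrow> computable n (G g)"
  shows "computables n (length gs) (\<lambda>xs. map (\<lambda>g. G g xs) gs)"
  using assms by (simp add: computables_def)

lemma computable_tuple:
  assumes F: "computable m F" and A: "computables n m A"
  shows "computable n (\<lambda>xs. F (A xs))"
proof -
  let ?Gs = "map (\<lambda>i xs. A xs ! i) [0..<m]"
  have "computable n (\<lambda>xs. F (map (\<lambda>G. G xs) ?Gs))"
    by (rule computable_comp) (use F A in \<open>auto simp: computables_def\<close>)
  then show ?thesis
  proof (rule computable_cong)
    fix xs :: "nat list" assume "length xs = n"
    then have "map (\<lambda>G. G xs) ?Gs = A xs"
      using A by (auto simp: list_eq_iff_nth_eq computables_def)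
    then show "F (map (\<lambda>G. G xs) ?Gs) = F (A xs)" by simp
  qed
qed

text \<open>\<open>Prf\<close> recurses on its first argument, so the recursion runs on
  \<open>A xs # xs\<close>. Its step receives counter, previous value and parameters in this order,
  hence the \<open>ys ! 0\<close>, \<open>ys ! 1\<close> and \<open>drop 2 ys\<close>.\<close>

lemma computable_rec:
  assumes A: "computable n A" and B: "computable n B"
    and G: "computable (Suc (Suc n)) (\<lambda>ys. G (ys ! 0) (ys ! 1) (drop 2 ys))"
  shows "computable n (\<lambda>xs. rec_nat (B xs) (\<lambda>i r. G i r xs) (A xs))"
proof -
  obtain b where b: "\<And>xs. length xs = n \<Longrightarrow> eval b xs (B xs)"
    using B unfolding computable_def by auto
  obtain g where g: "\<And>ys. length ys = Suc (Suc n) \<Longrightarrow> eval g ys (G (ys ! 0) (ys ! 1) (drop 2 ys))"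
    using G unfolding computable_def by auto
  have R: "eval (Prf b g) (x # xs) (rec_nat (B xs) (\<lambda>i r. G i r xs) x)" if "length xs = n" for x xs
  proof (induction x)
    case 0
    show ?case using b[OF that] by (auto intro: eval.prim0)
  next
    case (Suc x)
    let ?r = "rec_nat (B xs) (\<lambda>i r. G i r xs) x"
    have "eval g (x # ?r # xs) (G x ?r xs)"
      using g[of "x # ?r # xs"] that by simp
    from eval.primS[OF Suc this] show ?case by simp
  qed
  have "computable (Suc n) (\<lambda>ys. rec_nat (B (tl ys)) (\<lambda>i r. G i r (tl ys)) (hd ys))"
    unfolding computable_def
    by (rule exI[of _ "Prf b g"]) (use R in \<open>auto simp: length_Suc_conv\<close>)
  then have "computable n (\<lambda>xs. (\<lambda>ys. rec_nat (B (tl ys)) (\<lambda>i r. G i r (tl ys)) (hd ys)) (A xs # xs))"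
    by (rule computable_tuple) (intro computables_Cons A computables_id)
  then show ?thesis by simp
qed

lemma computable_drop2:
  assumes "computable n F"
  shows "computable (Suc (Suc n)) (\<lambda>ys. F (drop 2 ys))"
  using computable_tuple[OF assms computables_drop[of "Suc (Suc n)" 2 n "\<lambda>ys. ys"]]
  by (simp add: computables_id)

lemma computable_if:
  assumes "computable n A" "computable n B" "computable n C"
  shows "computable n (\<lambda>xs. if A xs = 0 then B xs else C xs)"
proof -
  \<comment> \<open>A recursion whose step forgets both counter and previous value is a test for
    zero.\<close>
  have "computable n (\<lambda>xs. rec_nat (B xs) (\<lambda>i r. C xs) (A xs))"
    by (rule computable_rec[where G = "\<lambda>i r xs. C xs"]) (auto intro: assms computable_drop2)
  then show ?thesis
    by (rule computable_cong) (auto split: nat.split simp: gr0_conv_Suc)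
qed

section \<open>Arithmetic, comparisons and finite tables\<close>

lemma computable_add:
  assumes "computable n A" "computable n B"
  shows "computable n (\<lambda>xs. A xs + B xs)"
proof -
  have "computable n (\<lambda>xs. rec_nat (A xs) (\<lambda>i r. Suc r) (B xs))"
    by (intro computable_rec[where G = "\<lambda>i r xs. Suc r"] assms computable_Suc computable_nth) auto
  moreover have "rec_nat a (\<lambda>i r. Suc r) b = a + b" for a b :: nat
    by (induction b) auto
  ultimately show ?thesis by simp
qed

lemma computable_mult:
  assumes "computable n A" "computable n B"
  shows "computable n (\<lambda>xs. A xs * B xs)"
proof -
  have "computable n (\<lambda>xs. rec_nat 0 (\<lambda>i r. r + A xs) (B xs))"
    by (intro computable_rec[where G = "\<lambda>i r xs. r + A xs"] assms computable_add
        computable_drop2 computable_zero computable_nth) auto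
  moreover have "rec_nat 0 (\<lambda>i r. r + a) b = a * b" for a b :: nat
    by (induction b) auto
  ultimately show ?thesis by simp
qed

lemma computable_pred:
  assumes "computable n A"
  shows "computable n (\<lambda>xs. A xs - 1)"
proof -
  have "computable n (\<lambda>xs. rec_nat 0 (\<lambda>i r. i) (A xs))"
    by (intro computable_rec[where G = "\<lambda>i r xs. i"] assms computable_zero computable_nth) auto
  moreover have "rec_nat 0 (\<lambda>i r. i) b = b - 1" for b :: nat
    by (cases b) auto
  ultimately show ?thesis by simp
qed

lemma computable_diff:
  assumes "computable n A" "computable n B"
  shows "computable n (\<lambda>xs. A xs - B xs)"
proof -
  have "computable n (\<lambda>xs. rec_nat (A xs) (\<lambda>i r. r - 1) (B xs))"
    by (intro computable_rec[where G = "\<lambda>i r xs. r - 1"] assms computable_pred computable_nth) auto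
  moreover have "rec_nat a (\<lambda>i r. r - 1) b = a - b" for a b :: nat
    by (induction b) auto
  ultimately show ?thesis by simp
qed

lemma computable_if_le:
  assumes "computable n A" "computable n B" "computable n C" "computable n D"
  shows "computable n (\<lambda>xs. if A xs \<le> B xs then C xs else D xs)"
  using computable_if[OF computable_diff[OF assms(1,2)] assms(3,4)] by simp

lemma computable_if_eq:
  assumes "computable n A" "computable n B" "computable n C" "computable n D"
  shows "computable n (\<lambda>xs. if A xs = B xs then C xs else D xs)"
proof -
  have "computable n (\<lambda>xs. if (A xs - B xs) + (B xs - A xs) = 0 then C xs else D xs)"
    by (intro computable_if computable_add computable_diff assms)
  then show ?thesis
    by (rule computable_cong) auto
qed

text \<open>A finite table is looked up by nested equality tests, so \<open>h\<close> may be any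
  function. This serves to invert letters on codes.\<close>

lemma computable_finite_support:
  assumes "finite A"
  shows "computable 1 (\<lambda>xs. if xs ! 0 \<in> A then h (xs ! 0) else 0)"
  using assms
proof induction
  case empty
  then show ?case by (simp add: computable_zero)
next
  case (insert a A)
  have "computable 1 (\<lambda>xs. if xs ! 0 = a then h a else (if xs ! 0 \<in> A then h (xs ! 0) else 0))"
    by (intro computable_if_eq computable_nth computable_const insert.IH) auto
  then show ?case by (rule computable_cong) auto
qed

lemma computable_prod_list:
  assumes "\<And>G. G \<in> set Gs \<Longrightarrow> computable n G"
  shows "computable n (\<lambda>xs. prod_list (map (\<lambda>G. G xs) Gs))"
  using assms by (induction Gs) (auto intro: computable_const computable_mult)

section \<open>The Cantor pairing function and its inverse\<close>

lemma computable_triangle: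
  assumes "computable n A"
  shows "computable n (\<lambda>xs. triangle (A xs))"
proof -
  have "computable n (\<lambda>xs. rec_nat 0 (\<lambda>i r. r + Suc i) (A xs))"
    by (intro computable_rec[where G = "\<lambda>i r xs. r + Suc i"] assms computable_add computable_Suc
        computable_zero computable_nth) auto
  moreover have "rec_nat 0 (\<lambda>i r. r + Suc i) b = triangle b" for b :: nat
    by (induction b) auto
  ultimately show ?thesis by simp
qed

lemma computable_prod_encode:
  assumes "computable n A" "computable n B"
  shows "computable n (\<lambda>xs. prod_encode (A xs, B xs))"
  unfolding prod_encode_def split by (intro computable_add computable_triangle assms)

text \<open>Pairs are enumerated along diagonals of constant \<open>a + b\<close>: the next pair is
  one step further on the diagonal, or opens the next diagonal when \<open>b = 0\<close>.\<close>

lemma prod_decode_Suc: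
  "prod_decode (Suc n) =
     (case prod_decode n of (a, b) \<Rightarrow> if b = 0 then (0, Suc a) else (Suc a, b - 1))"
proof -
  obtain a b where ab: "prod_decode n = (a, b)" by fastforce
  then have "n = prod_encode (a, b)" by (metis prod_decode_inverse)
  then have "Suc n = prod_encode (if b = 0 then (0, Suc a) else (Suc a, b - 1))"
    by (cases b) (simp_all add: prod_encode_def)
  then show ?thesis by (simp add: ab)
qed

lemma computable_prod_decode:
  assumes "computable n A"
  shows "computable n (\<lambda>xs. fst (prod_decode (A xs)))"
    and "computable n (\<lambda>xs. snd (prod_decode (A xs)))"
proof -
  \<comment> \<open>\<open>row m\<close> is the index of the diagonal containing \<open>m\<close>;
    it increases exactly when the next triangular number is reached. Both components then follow by
    subtraction.\<close>
  define row where "row = rec_nat 0 (\<lambda>i r. if triangle (Suc r) \<le> Suc i then Suc r else r)"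
  have row: "row m = fst (prod_decode m) + snd (prod_decode m)" for m
  proof (induction m)
    case 0
    show ?case by (simp add: row_def prod_decode_def prod_decode_aux.simps)
  next
    case (Suc m)
    obtain a b where ab: "prod_decode m = (a, b)" by fastforce
    then have "m = prod_encode (a, b)" by (metis prod_decode_inverse)
    then have "m = triangle (a + b) + a" by (simp add: prod_encode_def)
    then have "triangle (Suc (a + b)) \<le> Suc m \<longleftrightarrow> b = 0" by simp
    moreover have "row (Suc m) = (if triangle (Suc (row m)) \<le> Suc m then Suc (row m) else row m)"
      by (simp add: row_def)
    ultimately show ?case using Suc.IH by (cases b) (simp_all add: prod_decode_Suc ab)
  qed
  have R: "computable n (\<lambda>xs. row (A xs))"
    unfolding row_def
    by (intro computable_rec[where G = "\<lambda>i r xs. if triangle (Suc r) \<le> Suc i then Suc r else r"]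
        computable_if_le computable_triangle computable_Suc computable_zero computable_nth assms) auto
  have F: "m - triangle (row m) = fst (prod_decode m)" for m
  proof -
    obtain a b where ab: "prod_decode m = (a, b)" by fastforce
    then have "m = prod_encode (a, b)" by (metis prod_decode_inverse)
    then have "m - triangle (a + b) = a" by (simp add: prod_encode_def)
    then show ?thesis by (simp add: row ab)
  qed
  have "computable n (\<lambda>xs. A xs - triangle (row (A xs)))"
    by (intro computable_diff computable_triangle assms R)
  then show 1: "computable n (\<lambda>xs. fst (prod_decode (A xs)))" unfolding F .
  have "computable n (\<lambda>xs. row (A xs) - fst (prod_decode (A xs)))"
    by (intro computable_diff R 1)
  then show "computable n (\<lambda>xs. snd (prod_decode (A xs)))" by (simp add: row)
qed

subsection \<open>Stagewise evaluation of partial recursive functions\<close>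

inductive_cases eval_ZfE: "eval Zf xs r"
inductive_cases eval_SfE: "eval Sf xs r"
inductive_cases eval_IdfE: "eval (Idf i) xs r"
inductive_cases eval_CnfE: "eval (Cnf f gs) xs r"
inductive_cases eval_PrfE: "eval (Prf f g) xs r"
inductive_cases eval_MnfE: "eval (Mnf f) xs r"

text \<open>The value of \<open>F\<close> at stage \<open>s\<close> is 0 if no result of \<open>f\<close> is known yet, and \<open>r + 1\<close> if \<open>f\<close> is
  known to return \<open>r\<close>.\<close>
definition stages :: "nat \<Rightarrow> recf \<Rightarrow> (nat list \<Rightarrow> nat) \<Rightarrow> bool" where
  "stages n f F \<longleftrightarrow> computable (Suc n) F \<and>
     (\<forall>xs s r. length xs = n \<longrightarrow> F (s # xs) = Suc r \<longrightarrow> eval f xs r) \<and>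
     (\<forall>xs r. length xs = n \<longrightarrow> eval f xs r \<longrightarrow> (\<forall>\<^sub>F s in sequentially. F (s # xs) = Suc r))"

lemma stagesI:
  assumes "computable (Suc n) F"
    and "\<And>xs s r. length xs = n \<Longrightarrow> F (s # xs) = Suc r \<Longrightarrow> eval f xs r"
    and "\<And>xs r. length xs = n \<Longrightarrow> eval f xs r \<Longrightarrow> \<forall>\<^sub>F s in sequentially. F (s # xs) = Suc r"
  shows "stages n f F"
  using assms unfolding stages_def by blast

lemma stagesD:
  assumes "stages n f F"
  shows "computable (Suc n) F"
    and "length xs = n \<Longrightarrow> F (s # xs) = Suc r \<Longrightarrow> eval f xs r"
    and "length xs = n \<Longrightarrow> eval f xs r \<Longrightarrow> \<forall>\<^sub>F s in sequentially. F (s # xs) = Suc r"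
  using assms unfolding stages_def by blast+

text \<open>The product is nonzero exactly when all inner values are known, and subtracting 1
  recovers them. Being finitely many, they are all known from some common stage on.\<close>

lemma stages_Cnf:
  assumes f: "stages (length gs) f F" and G: "\<And>g. g \<in> set gs \<Longrightarrow> stages n g (G g)"
  shows "stages n (Cnf f gs) (\<lambda>ys. if prod_list (map (\<lambda>g. G g ys) gs) = 0 then 0
           else F (ys ! 0 # map (\<lambda>g. G g ys - 1) gs))"
    (is "stages n _ ?H")
proof (rule stagesI)
  have "computable (Suc n) (\<lambda>ys. prod_list (map (\<lambda>h. h ys) (map G gs)))"
    by (rule computable_prod_list) (auto dest: G stagesD(1))
  then have 1: "computable (Suc n) (\<lambda>ys. prod_list (map (\<lambda>g. G g ys) gs))"
    by (simp add: comp_def)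
  have 2: "computable (Suc n) (\<lambda>ys. F (ys ! 0 # map (\<lambda>g. G g ys - 1) gs))"
    by (intro computable_tuple[OF stagesD(1)[OF f]] computables_Cons computables_map
        computable_nth computable_pred stagesD(1)[OF G]) auto
  show "computable (Suc n) ?H"
    by (intro computable_if 1 2 computable_zero)
next
  fix xs s r assume len: "length xs = n" and H: "?H (s # xs) = Suc r"
  let ?ys = "map (\<lambda>g. G g (s # xs) - 1) gs"
  from H have nz: "\<forall>g\<in>set gs. G g (s # xs) \<noteq> 0" and F: "F (s # ?ys) = Suc r"
    by (auto simp: prod_list_zero_iff split: if_splits)
  have "eval (gs ! i) xs (?ys ! i)" if "i < length gs" for i
    by (rule stagesD(2)[OF G[of "gs ! i"] len, of s]) (use that nz in auto)
  moreover have "eval f ?ys r"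
    by (rule stagesD(2)[OF f _ F]) simp
  ultimately show "eval (Cnf f gs) xs r"
    by (intro eval.comp[of ?ys]) auto
next
  fix xs r assume len: "length xs = n" and "eval (Cnf f gs) xs r"
  then obtain ys where ys: "length ys = length gs"
    "\<forall>i<length gs. eval (gs ! i) xs (ys ! i)" "eval f ys r"
    by (auto elim: eval_CnfE)
  have "\<forall>i\<in>{..<length gs}. \<forall>\<^sub>F s in sequentially. G (gs ! i) (s # xs) = Suc (ys ! i)"
    using ys(2) stagesD(3)[OF G len] by auto
  then have "\<forall>\<^sub>F s in sequentially. \<forall>i\<in>{..<length gs}. G (gs ! i) (s # xs) = Suc (ys ! i)"
    by (intro eventually_ball_finite) auto
  moreover have "\<forall>\<^sub>F s in sequentially. F (s # ys) = Suc r"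
    by (rule stagesD(3)[OF f]) (use ys in auto)
  ultimately show "\<forall>\<^sub>F s in sequentially. ?H (s # xs) = Suc r"
  proof eventually_elim
    case (elim s)
    then have "map (\<lambda>g. G g (s # xs) - 1) gs = ys"
      using ys(1) by (auto simp: list_eq_iff_nth_eq)
    moreover have "\<forall>g\<in>set gs. G g (s # xs) \<noteq> 0"
      using elim(1) by (auto simp: in_set_conv_nth)
    ultimately show ?case using elim(2) by (auto simp: prod_list_zero_iff)
  qed
qed

text \<open>The value 0 is absorbing in the recursion: an unknown value stays unknown. All calls
  share one stage, and the finitely many that matter eventually succeed together.\<close>

lemma stages_Prf:
  assumes f: "stages n f F" and g: "stages (Suc (Suc n)) g G"
  shows "stages (Suc n) (Prf f g) (\<lambda>ys. rec_nat (F (ys ! 0 # drop 2 ys))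
           (\<lambda>i r. if r = 0 then 0 else G (ys ! 0 # i # (r - 1) # drop 2 ys)) (ys ! 1))"
    (is "stages _ _ ?H")
proof (rule stagesI)
  have 1: "computable (Suc (Suc n)) (\<lambda>ys. F (ys ! 0 # drop 2 ys))"
    by (intro computable_tuple[OF stagesD(1)[OF f]] computables_Cons computables_drop
        computable_nth) (auto intro: computables_id)
  have 2: "computable (Suc (Suc (Suc (Suc n)))) (\<lambda>zs. if zs ! 1 = 0 then 0
      else G (drop 2 zs ! 0 # zs ! 0 # (zs ! 1 - 1) # drop 2 (drop 2 zs)))"
    by (intro computable_if computable_tuple[OF stagesD(1)[OF g]] computables_Cons computables_drop
        computable_drop2 computable_pred computable_nth computable_zero)
      (auto intro: computables_id)
  show "computable (Suc (Suc n)) ?H"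
    by (rule computable_rec[where G = "\<lambda>i r ys. if r = 0 then 0 else G (ys ! 0 # i # (r - 1) # drop 2 ys)"])
      (use 1 2 in \<open>auto intro: computable_nth\<close>)
next
  fix xs s r assume len: "length xs = Suc n" and H: "?H (s # xs) = Suc r"
  obtain x ys where xs: "xs = x # ys" "length ys = n"
    using len by (auto simp: length_Suc_conv)
  let ?R = "rec_nat (F (s # ys)) (\<lambda>i r. if r = 0 then 0 else G (s # i # (r - 1) # ys))"
  have "?R x = Suc r \<Longrightarrow> eval (Prf f g) (x # ys) r" for x r
  proof (induction x arbitrary: r)
    case 0
    then show ?case using stagesD(2)[OF f xs(2)] by (auto intro: eval.prim0)
  next
    case (Suc x)
    then have p: "?R x \<noteq> 0" "G (s # x # (?R x - 1) # ys) = Suc r"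
      by (auto split: if_splits)
    then have "eval (Prf f g) (x # ys) (?R x - 1)" by (intro Suc.IH) simp
    moreover have "eval g (x # (?R x - 1) # ys) r"
      by (rule stagesD(2)[OF g _ p(2)]) (simp add: xs)
    ultimately show ?case by (rule eval.primS)
  qed
  with H show "eval (Prf f g) xs r" by (simp add: xs cong: if_cong)
next
  fix xs r assume len: "length xs = Suc n" and ev: "eval (Prf f g) xs r"
  obtain x ys where xs: "xs = x # ys" "length ys = n"
    using len by (auto simp: length_Suc_conv)
  have "eval (Prf f g) (x # ys) r \<Longrightarrow> \<forall>\<^sub>F s in sequentially. ?H (s # x # ys) = Suc r" for x r
  proof (induction x arbitrary: r)
    case 0
    then have "eval f ys r" by (auto elim: eval_PrfE)
    from stagesD(3)[OF f xs(2) this] show ?case by simp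
  next
    case (Suc x)
    then obtain p where p: "eval (Prf f g) (x # ys) p" "eval g (x # p # ys) r"
      by (auto elim: eval_PrfE)
    have "\<forall>\<^sub>F s in sequentially. G (s # x # p # ys) = Suc r"
      by (rule stagesD(3)[OF g _ p(2)]) (simp add: xs)
    with Suc.IH[OF p(1)] show ?case by eventually_elim (simp cong: if_cong)
  qed
  with ev show "\<forall>\<^sub>F s in sequentially. ?H (s # xs) = Suc r" by (simp add: xs cong: if_cong)
qed

text \<open>The inner state is 0 while searching, 1 once a value is not available at this stage, and
  \<open>i + 2\<close> once the zero \<open>i\<close> has been found.\<close>
lemma stages_Mnf:
  assumes f: "stages (Suc n) f F"
  shows "stages n (Mnf f) (\<lambda>ys. rec_nat 0
           (\<lambda>i q. if q = 0 then (if F (ys ! 0 # i # drop 1 ys) = 0 then 1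
                                  else if F (ys ! 0 # i # drop 1 ys) = 1 then i + 2 else 0)
                  else q) (ys ! 0) - 1)"
    (is "stages _ _ (\<lambda>ys. rec_nat 0 (?step ys) (ys ! 0) - 1)")
proof (rule stagesI)
  have 1: "computable (Suc (Suc (Suc n))) (\<lambda>zs. F (drop 2 zs ! 0 # zs ! 0 # drop 1 (drop 2 zs)))"
    by (intro computable_tuple[OF stagesD(1)[OF f]] computables_Cons computables_drop
        computable_drop2 computable_nth) (auto intro: computables_id)
  have "computable (Suc n) (\<lambda>ys. rec_nat 0 (?step ys) (ys ! 0))"
    by (rule computable_rec[where G = "\<lambda>i q ys. ?step ys i q"])
      (intro computable_nth computable_if computable_if_eq computable_const computable_add 1 | simp)+
  then show "computable (Suc n) (\<lambda>ys. rec_nat 0 (?step ys) (ys ! 0) - 1)"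
    by (rule computable_pred)
next
  fix xs s r assume len: "length xs = n" and "rec_nat 0 (?step (s # xs)) ((s # xs) ! 0) - 1 = Suc r"
  then have H: "rec_nat 0 (?step (s # xs)) s = r + 2" by simp
  \<comment> \<open>State 0 after \<open>t\<close> rounds certifies that every candidate below
    \<open>t\<close> has a known nonzero result, which is what a stage value above 1 means. The
    second half keeps this record once the search has stopped at \<open>r\<close>.\<close>
  have "(rec_nat 0 (?step (s # xs)) t = 0 \<longrightarrow> (\<forall>m<t. F (s # m # xs) > 1)) \<and>
        (rec_nat 0 (?step (s # xs)) t = r + 2 \<longrightarrow> F (s # r # xs) = 1 \<and> (\<forall>m<r. F (s # m # xs) > 1))" for t
    by (induction t) (auto simp: less_Suc_eq split: if_splits)
  with H have r: "F (s # r # xs) = 1" and m: "\<And>m. m < r \<Longrightarrow> F (s # m # xs) > 1" by auto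
  have "eval f (r # xs) 0"
    by (rule stagesD(2)[OF f]) (use len r in auto)
  moreover have "\<exists>p. eval f (m # xs) p \<and> p \<noteq> 0" if "m < r" for m
    using m[OF that] len by (intro exI[of _ "F (s # m # xs) - 1"] conjI stagesD(2)[OF f]) auto
  ultimately show "eval (Mnf f) xs r" by (auto intro: eval.mu)
next
  fix xs r assume len: "length xs = n" and "eval (Mnf f) xs r"
  then have r: "eval f (r # xs) 0" and m: "\<forall>m<r. \<exists>p. eval f (m # xs) p \<and> p \<noteq> 0"
    by (auto elim: eval_MnfE)
  have "\<forall>\<^sub>F s in sequentially. F (s # m # xs) > 1" if "m < r" for m
  proof -
    obtain p where "eval f (m # xs) p" "p \<noteq> 0" using m \<open>m < r\<close> by blast
    with stagesD(3)[OF f, of "m # xs" p] len show ?thesis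
      by (auto elim: eventually_mono)
  qed
  then have "\<forall>\<^sub>F s in sequentially. \<forall>m\<in>{..<r}. F (s # m # xs) > 1"
    by (intro eventually_ball_finite) auto
  moreover have "\<forall>\<^sub>F s in sequentially. F (s # r # xs) = Suc 0"
    by (rule stagesD(3)[OF f _ r]) (use len in auto)
  \<comment> \<open>Stage \<open>s\<close> tries only candidates below \<open>s\<close>.\<close>
  moreover have "\<forall>\<^sub>F s in sequentially. r < s" by (rule eventually_gt_at_top)
  ultimately show "\<forall>\<^sub>F s in sequentially. rec_nat 0 (?step (s # xs)) ((s # xs) ! 0) - 1 = Suc r"
  proof eventually_elim
    case (elim s)
    have "rec_nat 0 (?step (s # xs)) t = 0" if "t \<le> r" for t
      using that
    proof (induction t)
      case (Suc t)
      then have "F (s # t # xs) > 1" using elim(1) by simp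
      with Suc show ?case by simp
    qed simp
    then have "rec_nat 0 (?step (s # xs)) (Suc r) = r + 2" using elim(2) by simp
    then have "rec_nat 0 (?step (s # xs)) (Suc r + t) = r + 2" for t by (induction t) auto
    from this[of "s - Suc r"] elim(3) show ?case by simp
  qed
qed

text \<open>The arity is generalised because subterms run at other arities. A code that never
  returns at the given arity, such as \<open>Sf\<close> on the empty list, gets the constant
  0.\<close>

lemma stages_exist: "\<exists>F. stages n f F"
proof (induction f arbitrary: n)
  case (Zf n)
  have "stages n Zf (\<lambda>ys. 1)"
    by (rule stagesI) (auto intro: computable_const eval.zero elim: eval_ZfE)
  then show ?case by blast
next
  case (Sf n)
  show ?case
  proof (cases n)
    case 0
    have "stages n Sf (\<lambda>ys. 0)"
      by (rule stagesI) (auto intro: computable_const elim: eval_SfE simp: 0)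
    then show ?thesis by blast
  next
    case (Suc m)
    have "stages n Sf (\<lambda>ys. Suc (Suc (ys ! 1)))"
      by (rule stagesI)
        (auto intro!: computable_Suc computable_nth eval.succ elim: eval_SfE simp: Suc length_Suc_conv)
    then show ?thesis by blast
  qed
next
  case (Idf i n)
  show ?case
  proof (cases "i < n")
    case True
    have "stages n (Idf i) (\<lambda>ys. Suc (ys ! Suc i))"
      by (rule stagesI)
        (use True in \<open>auto intro!: computable_Suc computable_nth eval.proj elim: eval_IdfE\<close>)
    then show ?thesis by blast
  next
    case False
    have "stages n (Idf i) (\<lambda>ys. 0)"
      by (rule stagesI) (use False in \<open>auto intro: computable_const elim: eval_IdfE\<close>)
    then show ?thesis by blast
  qed
next
  case (Cnf f gs n)
  then obtain F where "stages (length gs) f F" by blast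
  moreover have "\<forall>g\<in>set gs. \<exists>G. stages n g G" using Cnf(2) by blast
  then obtain G where "\<And>g. g \<in> set gs \<Longrightarrow> stages n g (G g)"
    using bchoice by metis
  ultimately show ?case using stages_Cnf by blast
next
  case (Prf f g n)
  show ?case
  proof (cases n)
    case 0
    have "stages n (Prf f g) (\<lambda>ys. 0)"
      by (rule stagesI) (auto intro: computable_const elim: eval_PrfE simp: 0)
    then show ?thesis by blast
  next
    case (Suc m)
    then show ?thesis using Prf stages_Prf by blast
  qed
next
  case (Mnf f n)
  then show ?case using stages_Mnf by blast
qed

text \<open>Two results would both have to be the value of the same function at all late
  stages.\<close>

lemma eval_deterministic:
  assumes "eval f xs r" "eval f xs r'"
  shows "r = r'"
proof -
  obtain F where F: "stages (length xs) f F" using stages_exist by blast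
  have "\<forall>\<^sub>F s in sequentially. Suc r = Suc r'"
    using stagesD(3)[OF F refl assms(1)] stagesD(3)[OF F refl assms(2)]
    by eventually_elim simp
  then show ?thesis by simp
qed

subsection \<open>Quotients of reduced words\<close>

definition linv :: "nat \<times> bool \<Rightarrow> nat \<times> bool" where
  "linv a = (fst a, \<not> snd a)"

lemma linv_linv [simp]: "linv (linv a) = a"
  and fst_linv [simp]: "fst (linv a) = fst a"
  and linv_neq [simp]: "linv a \<noteq> a" "a \<noteq> linv a"
  and linv_eq_iff [simp]: "linv a = linv b \<longleftrightarrow> a = b"
  by (auto simp: linv_def prod_eq_iff)

definition winv :: "word \<Rightarrow> word" where
  "winv w = rev (map linv w)"

lemma winv_winv [simp]: "winv (winv w) = w"
  by (simp add: winv_def rev_map comp_def)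

lemma winv_Nil [simp]: "winv [] = []"
  and winv_Cons: "winv (a # w) = winv w @ [linv a]"
  and length_winv [simp]: "length (winv w) = length w"
  and winv_eq_Nil [simp]: "winv w = [] \<longleftrightarrow> w = []"
  by (simp_all add: winv_def)

text \<open>In this form the facts about \<open>successively\<close> under append and map
  apply.\<close>

lemma reduced_iff: "reduced w \<longleftrightarrow> successively (\<lambda>a b. b \<noteq> linv a) w"
proof (induction w rule: reduced.induct)
  case (1 a b w)
  have "(fst a = fst b \<and> snd a \<noteq> snd b) \<longleftrightarrow> b = linv a"
    by (auto simp: linv_def prod_eq_iff)
  with 1 show ?case by simp
qed auto

lemma reduced_Cons: "reduced (a # w) \<longleftrightarrow> reduced w \<and> (w = [] \<or> hd w \<noteq> linv a)"
  by (auto simp: reduced_iff successively_Cons)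

lemma reduced_winv: "reduced w \<Longrightarrow> reduced (winv w)"
  by (simp add: reduced_iff winv_def successively_map)
    (metis (mono_tags, lifting) linv_linv successively_mono)

lemma FX_Nil [simp]: "[] \<in> FX k"
  by (simp add: FX_def)

lemma FX_Cons: "a # w \<in> FX k \<longleftrightarrow> fst a < k \<and> w \<in> FX k \<and> (w = [] \<or> hd w \<noteq> linv a)"
  by (auto simp: FX_def reduced_Cons)

lemma FX_append: "u @ v \<in> FX k \<longleftrightarrow>
    u \<in> FX k \<and> v \<in> FX k \<and> (u = [] \<or> v = [] \<or> hd v \<noteq> linv (last u))"
  by (auto simp: FX_def reduced_iff successively_append_iff)

lemma FX_winv: "w \<in> FX k \<Longrightarrow> winv w \<in> FX k"
  using reduced_winv by (auto simp: FX_def winv_def)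

text \<open>Left multiplication of a reduced word by a letter: at most one cancellation occurs, at
  the head.\<close>

fun push :: "nat \<times> bool \<Rightarrow> word \<Rightarrow> word" where
  "push a [] = [a]"
| "push a (b # w) = (if b = linv a then w else a # b # w)"

lemma push_noncancel: "w = [] \<or> hd w \<noteq> linv a \<Longrightarrow> push a w = a # w"
  by (cases w) auto

lemma push_FX: "w \<in> FX k \<Longrightarrow> fst a < k \<Longrightarrow> push a w \<in> FX k"
  by (cases w) (auto simp: FX_Cons)

text \<open>If \<open>w\<close> begins with \<open>a\<close>, cancelling it leaves a tail that does
  not begin with \<open>linv a\<close>, as \<open>w\<close> is reduced, so \<open>a\<close> can be
  put back. Hence letters act bijectively on reduced words.\<close>

lemma push_push: "reduced w \<Longrightarrow> push a (push (linv a) w) = w"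
  by (cases w) (auto simp: reduced_Cons push_noncancel)

text \<open>For reduced words, \<open>ldiv u v\<close> is the reduced form of \<open>u\<^sup>-\<^sup>1 v\<close>.\<close>
fun ldiv :: "word \<Rightarrow> word \<Rightarrow> word" where
  "ldiv [] v = v"
| "ldiv (a # u) v = ldiv u (push (linv a) v)"

lemma ldiv_FX: "v \<in> FX k \<Longrightarrow> \<forall>a\<in>set u. fst a < k \<Longrightarrow> ldiv u v \<in> FX k"
  by (induction u arbitrary: v) (auto simp: push_FX)

lemma FX_letters: "w \<in> FX k \<Longrightarrow> \<forall>a\<in>set w. fst a < k"
  by (simp add: FX_def)

lemma ldiv_append: "ldiv (u @ u') v = ldiv u' (ldiv u v)"
  by (induction u arbitrary: v) auto

text \<open>The first inverse letter does not cancel and then shields \<open>v\<close>: the next one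
  could cancel only against it, which reducedness of \<open>u\<close> excludes.\<close>

lemma ldiv_noncancel:
  "reduced u \<Longrightarrow> u = [] \<or> v = [] \<or> hd u \<noteq> hd v \<Longrightarrow> ldiv u v = winv u @ v"
proof (induction u arbitrary: v)
  case (Cons a u)
  then have "push (linv a) v = linv a # v"
    by (intro push_noncancel) auto
  moreover have "ldiv u (linv a # v) = winv u @ linv a # v"
    using Cons.prems by (intro Cons.IH) (auto simp: reduced_Cons)
  ultimately show ?case by (simp add: winv_Cons)
qed simp

lemma ldiv_common_prefix: "ldiv (p @ u) (p @ v) = ldiv u v"
  by (induction p) auto

text \<open>A splitting of a reduced word has no cancellation at its seam. This supplies the lower
  bound for fibres.\<close>

lemma ldiv_winv:
  assumes "x @ y \<in> FX k"
  shows "ldiv (winv x) y = x @ y"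
proof -
  have "hd (winv x) = linv (last x)" if "x \<noteq> []"
    using that by (simp add: winv_def hd_rev last_map)
  moreover have "x = [] \<or> y = [] \<or> hd y \<noteq> linv (last x)"
    using assms by (simp add: FX_append)
  moreover have "winv x \<in> FX k"
    using assms by (simp add: FX_append FX_winv)
  then have "reduced (winv x)" by (simp add: FX_def)
  ultimately have "ldiv (winv x) y = winv (winv x) @ y"
    by (intro ldiv_noncancel) fastforce+
  then show ?thesis by simp
qed

text \<open>The letters of \<open>winv u\<close> undo those of \<open>u\<close> in reverse order. So
  a pair can be recovered from its first component and its quotient.\<close>

lemma ldiv_winv_ldiv: "v \<in> FX k \<Longrightarrow> \<forall>a\<in>set u. fst a < k \<Longrightarrow> ldiv (winv u) (ldiv u v) = v"
proof (induction u arbitrary: v)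
  case (Cons a u)
  then show ?case
    by (simp add: winv_Cons ldiv_append push_FX) (simp add: push_push FX_def)
qed simp

text \<open>Remove the longest common prefix \<open>p\<close>; what is left cannot cancel. Thus the
  lengths of \<open>u\<close> and \<open>v\<close> add up to that of the quotient plus twice that of
  \<open>p\<close>.\<close>

lemma ldiv_decompose:
  assumes "u \<in> FX k" "v \<in> FX k"
  obtains p u' v' where "u = p @ u'" "v = p @ v'" "ldiv u v = winv u' @ v'"
proof -
  have "\<exists>p u' v'. u = p @ u' \<and> v = p @ v' \<and> (u' = [] \<or> v' = [] \<or> hd u' \<noteq> hd v')" for u v :: word
  proof (induction u arbitrary: v)
    case (Cons a u)
    show ?case
    proof (cases "v \<noteq> [] \<and> hd v = a")
      case True
      then obtain v1 where v: "v = a # v1" by (cases v) auto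
      obtain p u' v' where "u = p @ u'" "v1 = p @ v'" "u' = [] \<or> v' = [] \<or> hd u' \<noteq> hd v'"
        using Cons by blast
      then have "a # u = (a # p) @ u' \<and> v = (a # p) @ v' \<and> (u' = [] \<or> v' = [] \<or> hd u' \<noteq> hd v')"
        by (auto simp: v)
      then show ?thesis by blast
    qed (auto intro: exI[of _ "[]"])
  qed auto
  then obtain p u' v' where p: "u = p @ u'" "v = p @ v'" "u' = [] \<or> v' = [] \<or> hd u' \<noteq> hd v'"
    by blast
  moreover have "reduced u'" using assms(1) p(1) FX_append[of p u' k] by (simp add: FX_def)
  ultimately have "ldiv u v = winv u' @ v'"
    by (simp add: ldiv_common_prefix ldiv_noncancel)
  with p that show ?thesis by blast
qed

subsection \<open>Ball sizes and fibre sizes\<close>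

definition sphere :: "nat \<Rightarrow> nat \<Rightarrow> word set" where
  "sphere k l = {w \<in> FX k. length w = l}"

lemma finite_letters: "finite {a :: nat \<times> bool. fst a < k}"
  and card_letters: "card {a :: nat \<times> bool. fst a < k} = 2 * k"
proof -
  have eq: "{a :: nat \<times> bool. fst a < k} = {..<k} \<times> UNIV" by auto
  show "finite {a :: nat \<times> bool. fst a < k}" unfolding eq by simp
  show "card {a :: nat \<times> bool. fst a < k} = 2 * k" unfolding eq by (simp add: card_cartesian_product)
qed

lemma finite_ball1: "finite (ball1 k n)"
proof (rule finite_subset)
  show "ball1 k n \<subseteq> {w :: word. set w \<subseteq> {a. fst a < k} \<and> length w \<le> n}"
    by (auto simp: ball1_def FX_def)
qed (intro finite_lists_length_le finite_letters)

lemma finite_sphere: "finite (sphere k l)"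
  by (rule finite_subset[OF _ finite_ball1[of k l]]) (auto simp: sphere_def ball1_def)

lemma ball2_subset: "ball2 k n \<subseteq> ball1 k n \<times> ball1 k n"
  by (auto simp: ball1_def ball2_def)

lemma finite_ball2: "finite (ball2 k n)"
  by (rule finite_subset[OF ball2_subset]) (simp add: finite_ball1)

lemma card_sphere_0: "card (sphere k 0) = 1"
proof -
  have "sphere k 0 = {[]}" by (auto simp: sphere_def)
  then show ?thesis by simp
qed

text \<open>A letter may be put in front of a nonempty reduced word unless it is the inverse of the
  head, which leaves \<open>2 * k - 1\<close> choices.\<close>

lemma card_sphere_Suc: "card (sphere k (Suc l)) = 2 * k * (2 * k - 1) ^ l"
proof (induction l)
  case 0
  have "sphere k (Suc 0) = (\<lambda>a. [a]) ` {a. fst a < k}"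
    by (auto simp: sphere_def length_Suc_conv FX_Cons)
  then show ?case by (simp add: card_image inj_on_def card_letters)
next
  case (Suc l)
  let ?S = "SIGMA w:sphere k (Suc l). {a. fst a < k} - {linv (hd w)}"
  have "sphere k (Suc (Suc l)) = (\<lambda>(w, a). a # w) ` ?S"
  proof (intro equalityI subsetI)
    fix w assume "w \<in> sphere k (Suc (Suc l))"
    then obtain a v where v: "w = a # v" "v \<in> sphere k (Suc l)" "fst a < k" "hd v \<noteq> linv a"
      by (auto simp: sphere_def length_Suc_conv FX_Cons)
    then have "(v, a) \<in> ?S" by auto
    then show "w \<in> (\<lambda>(w, a). a # w) ` ?S" using v(1) by force
  qed (auto simp: sphere_def FX_Cons)
  then have "card (sphere k (Suc (Suc l))) = card ?S"
    by (simp add: card_image inj_on_def split_beta prod_eq_iff)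
  also have "\<dots> = (\<Sum>w\<in>sphere k (Suc l). card ({a. fst a < k} - {linv (hd w)}))"
    by (intro card_SigmaI) (auto simp: finite_sphere finite_letters)
  also have "\<dots> = (\<Sum>w\<in>sphere k (Suc l). 2 * k - 1)"
  proof (intro sum.cong refl)
    fix w assume "w \<in> sphere k (Suc l)"
    then have "fst (linv (hd w)) < k" by (cases w) (auto simp: sphere_def FX_Cons)
    then show "card ({a. fst a < k} - {linv (hd w)}) = 2 * k - 1"
      by (simp add: card_Diff_singleton finite_letters card_letters)
  qed
  finally show ?case using Suc by simp
qed

definition sphere_size :: "nat \<Rightarrow> nat \<Rightarrow> nat" where "sphere_size k l = card (sphere k l)"
definition ball_size :: "nat \<Rightarrow> nat \<Rightarrow> nat" where "ball_size k n = card (ball1 k n)"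

lemma ball1_UN: "ball1 k n = (\<Union>l\<le>n. sphere k l)"
  by (auto simp: ball1_def sphere_def)

lemma sum_over_ball:
  fixes f :: "word \<Rightarrow> 'a :: comm_monoid_add"
  shows "sum f (N \<inter> ball1 k n) = (\<Sum>l\<le>n. sum f (N \<inter> sphere k l))"
proof -
  have "N \<inter> ball1 k n = (\<Union>l\<le>n. N \<inter> sphere k l)"
    by (auto simp: ball1_UN)
  then show ?thesis
    by (simp only:) (rule sum.UNION_disjoint, auto simp: finite_sphere, auto simp: sphere_def)
qed

lemma card_ball1: "ball_size k n = (\<Sum>l\<le>n. sphere_size k l)"
  using sum_over_ball[of "\<lambda>_. 1 :: nat" UNIV k n] by (simp add: ball_size_def sphere_size_def)

lemma sphere_size_simps: "sphere_size k 0 = 1" "sphere_size k (Suc l) = 2 * k * (2 * k - 1) ^ l"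
  by (simp_all add: sphere_size_def card_sphere_0 card_sphere_Suc)

lemma sphere_size_mono: assumes "k \<ge> 1" shows "l \<le> m \<Longrightarrow> sphere_size k l \<le> sphere_size k m"
proof (rule lift_Suc_mono_le[of "sphere_size k"])
  fix n show "sphere_size k n \<le> sphere_size k (Suc n)"
    using assms by (cases n) (auto simp: sphere_size_simps mult_le_mono)
qed

text \<open>For positive lengths everything reduces to \<open>2 * k \<le> 2 * (2 * k - 1)\<close>,
  which truncated subtraction makes true for \<open>k = 0\<close> as well.\<close>

lemma sphere_size_mult: "sphere_size k i * sphere_size k j \<le> 2 * sphere_size k (i + j)"
proof (cases "i = 0 \<or> j = 0")
  case False
  then obtain i' j' where ij: "i = Suc i'" "j = Suc j'" by (meson not0_implies_Suc)
  have "2 * k \<le> 2 * (2 * k - 1)" by (cases k) auto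
  then have "(2 * k * (2 * k - 1) ^ (i' + j')) * (2 * k) \<le> (2 * k * (2 * k - 1) ^ (i' + j')) * (2 * (2 * k - 1))"
    by (rule mult_le_mono2)
  then show ?thesis by (simp add: ij sphere_size_simps power_add algebra_simps)
qed (auto simp: sphere_size_simps)

lemma ball_size_pos: "ball_size k n > 0"
proof -
  have "[] \<in> ball1 k n" by (simp add: ball1_def)
  then show ?thesis unfolding ball_size_def by (subst card_gt_0_iff) (auto simp: finite_ball1)
qed

lemma ball_size_le_sphere: assumes "k \<ge> 1" shows "ball_size k n \<le> (n + 1) * sphere_size k n"
proof -
  have "ball_size k n \<le> (\<Sum>l\<le>n. sphere_size k n)"
    unfolding card_ball1 by (intro sum_mono sphere_size_mono assms) auto
  then show ?thesis by simp
qed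

lemma ball_size_Suc: "ball_size k (Suc n) = ball_size k n + sphere_size k (Suc n)"
  by (simp add: card_ball1)

text \<open>The mean sphere size \<open>ball_size k n / (n + 1)\<close> does not decrease, as every
  new sphere is at least as large as the earlier ones.\<close>

lemma ball_size_linear_growth:
  assumes "k \<ge> 1" "m \<le> n" shows "ball_size k m * (n + 1) \<le> ball_size k n * (m + 1)"
  using assms(2)
proof (induction rule: dec_induct)
  case (step n)
  have "ball_size k n \<le> (n + 1) * sphere_size k (Suc n)"
    using ball_size_le_sphere[OF assms(1), of n] sphere_size_mono[OF assms(1), of n "Suc n"]
    by (meson le_SucI le_refl le_trans mult_le_mono2)
  then have "ball_size k n * (n + 2) \<le> ball_size k (Suc n) * (n + 1)"
    by (simp add: ball_size_Suc algebra_simps)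
  then have "ball_size k n * (m + 1) * (n + 2) \<le> ball_size k (Suc n) * (m + 1) * (n + 1)"
    by (metis mult.assoc mult.commute mult_le_mono1)
  moreover have "ball_size k m * (n + 1) * (n + 2) \<le> ball_size k n * (m + 1) * (n + 2)"
    using step.IH by (rule mult_le_mono1)
  ultimately have "ball_size k m * (n + 1) * (n + 2) \<le> ball_size k (Suc n) * (m + 1) * (n + 1)"
    by (rule order_trans[rotated])
  then have "(ball_size k m * (n + 2)) * (n + 1) \<le> (ball_size k (Suc n) * (m + 1)) * (n + 1)"
    by (simp only: mult.assoc mult.commute[of "n + 1" "n + 2"])
  then have "ball_size k m * (n + 2) \<le> ball_size k (Suc n) * (m + 1)"
    by (subst (asm) mult_le_cancel2) simp
  then show ?case by simp
qed simp

text \<open>Since spheres do not shrink, the mean of \<open>l + 1\<close> over the ball is at least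
  \<open>(n + 2) / 2\<close>, its value when all spheres have the same size.\<close>

lemma sum_lengths_ball: assumes "k \<ge> 1"
  shows "(n + 2) * ball_size k n \<le> 2 * (\<Sum>l\<le>n. (l + 1) * sphere_size k l)"
proof (induction n)
  case (Suc n)
  have "ball_size k n \<le> (n + 1) * sphere_size k (Suc n)"
    using ball_size_le_sphere[OF assms(1), of n] sphere_size_mono[OF assms(1), of n "Suc n"]
    by (meson le_SucI le_refl le_trans mult_le_mono2)
  with Suc show ?case by (simp add: ball_size_Suc algebra_simps)
qed (simp add: card_ball1 sphere_size_simps)

text \<open>Pairs are sorted by total length \<open>l\<close> and first length \<open>i\<close>;
  each class has at most \<open>2 * sphere_size k l\<close> members, and each \<open>l\<close> has
  at most \<open>n + 1\<close> classes.\<close>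

lemma card_ball2_upper: "card (ball2 k n) \<le> 2 * (n + 1) * ball_size k n"
proof -
  have "ball2 k n \<subseteq> (\<Union>l\<le>n. \<Union>i\<le>l. sphere k i \<times> sphere k (l - i))"
  proof clarify
    fix u v assume "(u, v) \<in> ball2 k n"
    then show "(u, v) \<in> (\<Union>l\<le>n. \<Union>i\<le>l. sphere k i \<times> sphere k (l - i))"
      by (auto simp: ball2_def sphere_def intro!: bexI[of _ "length u + length v"])
  qed
  then have "card (ball2 k n) \<le> card (\<Union>l\<le>n. \<Union>i\<le>l. sphere k i \<times> sphere k (l - i))"
    by (intro card_mono) (auto simp: finite_sphere)
  also have "\<dots> \<le> (\<Sum>l\<le>n. card (\<Union>i\<le>l. sphere k i \<times> sphere k (l - i)))"
    by (intro card_UN_le) auto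
  also have "\<dots> \<le> (\<Sum>l\<le>n. \<Sum>i\<le>l. card (sphere k i \<times> sphere k (l - i)))"
    by (intro sum_mono card_UN_le) auto
  also have "\<dots> \<le> (\<Sum>l\<le>n. \<Sum>i\<le>l. 2 * sphere_size k l)"
  proof (intro sum_mono)
    fix l i :: nat assume "i \<in> {..l}"
    then show "card (sphere k i \<times> sphere k (l - i)) \<le> 2 * sphere_size k l"
      using sphere_size_mult[of k i "l - i"] by (simp add: card_cartesian_product sphere_size_def)
  qed
  also have "\<dots> \<le> (\<Sum>l\<le>n. 2 * (n + 1) * sphere_size k l)"
    by (intro sum_mono) (simp add: algebra_simps mult_le_mono)
  also have "\<dots> = 2 * (n + 1) * ball_size k n"
    by (simp add: card_ball1 sum_distrib_left)
  finally show ?thesis .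
qed

section \<open>Fibres of the quotient map\<close>

definition quotient_pairs :: "nat \<Rightarrow> word set \<Rightarrow> (word \<times> word) set" where
  "quotient_pairs k N = {(u, v). u \<in> FX k \<and> v \<in> FX k \<and> ldiv u v \<in> N}"

text \<open>The pair coming from a splitting remembers the word, as its quotient, and the position,
  as the length of its first component.\<close>

lemma splits_le_quotient_pairs:
  "(\<Sum>w\<in>N \<inter> ball1 k n. length w + 1) \<le> card (quotient_pairs k N \<inter> ball2 k n)"
proof -
  let ?A = "SIGMA w:N \<inter> ball1 k n. {..length w}"
  let ?f = "\<lambda>(w, i). (winv (take i w), drop i w)"
  have D: "ldiv (winv (take i w)) (drop i w) = w" if "w \<in> FX k" for w i
    using ldiv_winv[of "take i w" "drop i w" k] that by simp
  have "(\<Sum>w\<in>N \<inter> ball1 k n. length w + 1) = card ?A"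
    by (subst card_SigmaI) (auto simp: finite_ball1)
  also have "\<dots> = card (?f ` ?A)"
  proof (rule card_image[symmetric], rule inj_onI, clarify)
    fix w i w' i'
    assume *: "w \<in> ball1 k n" "w' \<in> ball1 k n" "i \<le> length w" "i' \<le> length w'"
      and eq: "winv (take i w) = winv (take i' w')" "drop i w = drop i' w'"
    from eq D[of w i] D[of w' i'] * have "w = w'" by (simp add: ball1_def)
    moreover from eq(1) have "length (take i w) = length (take i' w')" by (metis length_winv)
    ultimately show "w = w' \<and> i = i'" using * by simp
  qed
  also have "\<dots> \<le> card (quotient_pairs k N \<inter> ball2 k n)"
  proof (intro card_mono, clarsimp simp: finite_ball2, clarify)
    fix w i assume w: "w \<in> N" "w \<in> ball1 k n"
    then have "take i w \<in> FX k \<and> drop i w \<in> FX k"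
      using FX_append[of "take i w" "drop i w" k] by (simp add: ball1_def)
    with w D[of w i] show "(winv (take i w), drop i w) \<in> quotient_pairs k N \<inter> ball2 k n"
      by (auto simp: quotient_pairs_def ball1_def ball2_def FX_winv)
  qed
  finally show ?thesis .
qed

lemma card_ball2_lower:
  assumes "k \<ge> 1" shows "(n + 2) * ball_size k n \<le> 2 * card (ball2 k n)"
proof -
  have "(\<Sum>w\<in>ball1 k n. length w + 1) = (\<Sum>l\<le>n. (l + 1) * sphere_size k l)"
    using sum_over_ball[of "\<lambda>w. length w + 1" UNIV k n]
    by (simp add: sphere_def sphere_size_def algebra_simps)
  moreover have "card (quotient_pairs k UNIV \<inter> ball2 k n) \<le> card (ball2 k n)"
    by (intro card_mono finite_ball2) auto
  ultimately show ?thesis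
    using splits_le_quotient_pairs[of UNIV k n] sum_lengths_ball[OF assms, of n] by simp
qed

text \<open>A pair over \<open>w\<close> consists of a common prefix \<open>p\<close> and a
  splitting of \<open>w\<close>; the condition \<open>2 * length p + length w \<le> n\<close> limits
  \<open>p\<close>.\<close>

lemma quotient_pairs_le_fibres:
  "card (quotient_pairs k N \<inter> ball2 k n) \<le> (\<Sum>w\<in>N \<inter> ball1 k n. (length w + 1) * ball_size k ((n - length w) div 2))"
proof -
  let ?B = "\<lambda>w. {..length w} \<times> ball1 k ((n - length w) div 2)"
  let ?f = "\<lambda>w (i, p). (p @ winv (take i w), p @ drop i w)"
  have "quotient_pairs k N \<inter> ball2 k n \<subseteq> (\<Union>w\<in>N \<inter> ball1 k n. ?f w ` ?B w)"
  proof clarify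
    fix u v assume "(u, v) \<in> quotient_pairs k N" and uv2: "(u, v) \<in> ball2 k n"
    then have uv: "u \<in> FX k" "v \<in> FX k" "ldiv u v \<in> N" by (auto simp: quotient_pairs_def)
    obtain p u' v' where p: "u = p @ u'" "v = p @ v'" "ldiv u v = winv u' @ v'"
      using ldiv_decompose[OF uv(1,2)] .
    let ?w = "winv u' @ v'"
    from uv2 have len: "2 * length p + length ?w \<le> n" by (simp add: p ball2_def)
    have "?w \<in> FX k" using ldiv_FX[OF uv(2) FX_letters[OF uv(1)]] p(3) by simp
    then have "?w \<in> N \<inter> ball1 k n" using uv(3) p(3) len by (simp add: ball1_def)
    moreover have "(length u', p) \<in> ?B ?w"
      using len uv(1) by (auto simp: ball1_def p FX_append)
    moreover have "(u, v) = ?f ?w (length u', p)" by (simp add: p)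
    ultimately show "(u, v) \<in> (\<Union>w\<in>N \<inter> ball1 k n. ?f w ` ?B w)" by blast
  qed
  then have "card (quotient_pairs k N \<inter> ball2 k n) \<le> card (\<Union>w\<in>N \<inter> ball1 k n. ?f w ` ?B w)"
    by (intro card_mono) (auto simp: finite_ball1)
  also have "\<dots> \<le> (\<Sum>w\<in>N \<inter> ball1 k n. card (?f w ` ?B w))"
    by (intro card_UN_le) (simp add: finite_ball1)
  also have "\<dots> \<le> (\<Sum>w\<in>N \<inter> ball1 k n. card (?B w))"
    by (intro sum_mono card_image_le) (simp add: finite_ball1)
  finally show ?thesis by (simp add: ball_size_def card_cartesian_product)
qed

text \<open>Quotient and first component determine the pair, and both have length at most
  \<open>n\<close>. This cruder bound is for rank one.\<close>

lemma quotient_pairs_le_product: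
  "card (quotient_pairs k N \<inter> ball2 k n) \<le> card (N \<inter> ball1 k n) * ball_size k n"
proof -
  let ?f = "\<lambda>(u, v). (ldiv u v, u)"
  have "card (quotient_pairs k N \<inter> ball2 k n) = card (?f ` (quotient_pairs k N \<inter> ball2 k n))"
  proof (rule card_image[symmetric])
    have "v = v'" if "(u, v) \<in> ball2 k n" "(u, v') \<in> ball2 k n" "ldiv u v = ldiv u v'" for u v v'
    proof -
      from that have "u \<in> FX k" "v \<in> FX k" "v' \<in> FX k" by (auto simp: ball2_def)
      then have "ldiv (winv u) (ldiv u v) = v" "ldiv (winv u) (ldiv u v') = v'"
        by (auto intro!: ldiv_winv_ldiv dest: FX_letters)
      with that(3) show ?thesis by metis
    qed
    then show "inj_on ?f (quotient_pairs k N \<inter> ball2 k n)"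
      by (auto simp: inj_on_def)
  qed
  also have "\<dots> \<le> card ((N \<inter> ball1 k n) \<times> ball1 k n)"
  proof (intro card_mono subsetI)
    fix z assume "z \<in> ?f ` (quotient_pairs k N \<inter> ball2 k n)"
    then obtain u v where z: "z = (ldiv u v, u)"
      and *: "(u, v) \<in> quotient_pairs k N" "(u, v) \<in> ball2 k n" by auto
    from * have uv: "u \<in> FX k" "v \<in> FX k" "ldiv u v \<in> N" by (auto simp: quotient_pairs_def)
    obtain p u' v' where p: "u = p @ u'" "v = p @ v'" "ldiv u v = winv u' @ v'"
      using ldiv_decompose[OF uv(1,2)] .
    then have "length (ldiv u v) \<le> n" using * by (simp add: ball2_def)
    then show "z \<in> (N \<inter> ball1 k n) \<times> ball1 k n"
      using uv * ldiv_FX[OF uv(2) FX_letters[OF uv(1)]] by (simp add: z ball1_def ball2_def)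
  qed (simp add: finite_ball1)
  finally show ?thesis by (simp add: card_cartesian_product ball_size_def)
qed

subsection \<open>Negligible sets\<close>

text \<open>The weights have bounded sum and concentrate near \<open>l = n\<close>, where
  \<open>f\<close> is small. The proof runs on the recursion
  \<open>e (n + 1) = t * e n + f (n + 1)\<close>.\<close>

lemma geometric_convolution_tendsto_0:
  fixes f :: "nat \<Rightarrow> real"
  assumes f: "f \<longlonglongrightarrow> 0" and t: "0 \<le> t" "t < 1"
  shows "(\<lambda>n. \<Sum>l\<le>n. f l * t ^ (n - l)) \<longlonglongrightarrow> 0"
proof (rule LIMSEQ_I)
  define e where "e n = (\<Sum>l\<le>n. f l * t ^ (n - l))" for n
  have e_Suc: "e (Suc n) = t * e n + f (Suc n)" for n
  proof -
    have "(\<Sum>l\<le>n. f l * t ^ (Suc n - l)) = t * e n"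
      unfolding e_def sum_distrib_left by (intro sum.cong) (auto simp: Suc_diff_le)
    then show ?thesis by (simp add: e_def)
  qed
  fix r :: real assume "0 < r"
  \<comment> \<open>With this \<open>d\<close>, the number \<open>r / 2\<close> is the fixed point
    of \<open>x \<mapsto> t * x + d\<close>, so it bounds the accumulated perturbation.\<close>
  define d where "d = r * (1 - t) / 2"
  have "0 < d" using \<open>0 < r\<close> t by (simp add: d_def)
  then obtain N where N: "\<And>n. n \<ge> N \<Longrightarrow> \<bar>f n\<bar> < d"
    using LIMSEQ_D[OF f] by force
  have bound: "\<bar>e (N + m)\<bar> \<le> t ^ m * \<bar>e N\<bar> + r / 2" for m
  proof (induction m)
    case (Suc m)
    have "\<bar>e (N + Suc m)\<bar> \<le> t * \<bar>e (N + m)\<bar> + \<bar>f (Suc (N + m))\<bar>"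
      using t by (simp add: e_Suc) (metis abs_mult abs_of_nonneg abs_triangle_ineq)
    also have "\<dots> \<le> t * (t ^ m * \<bar>e N\<bar> + r / 2) + d"
      using N[of "Suc (N + m)"] Suc t by (intro add_mono mult_left_mono) auto
    also have "\<dots> = t ^ Suc m * \<bar>e N\<bar> + r / 2" by (simp add: d_def field_simps)
    finally show ?case .
  qed (use \<open>0 < r\<close> in simp)
  have "(\<lambda>m. t ^ m * \<bar>e N\<bar>) \<longlonglongrightarrow> 0 * \<bar>e N\<bar>"
    by (intro tendsto_mult LIMSEQ_power_zero tendsto_const) (use t in auto)
  then obtain M where M: "\<And>m. m \<ge> M \<Longrightarrow> t ^ m * \<bar>e N\<bar> < r / 2"
    using LIMSEQ_D[of "\<lambda>m. t ^ m * \<bar>e N\<bar>" 0 "r / 2"] \<open>0 < r\<close> t by auto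
  have "norm (e n - 0) < r" if "n \<ge> N + M" for n
    using bound[of "n - N"] M[of "n - N"] that by (simp add: le_diff_conv2)
  then show "\<exists>no. \<forall>n\<ge>no. norm ((\<Sum>l\<le>n. f l * t ^ (n - l)) - 0) < r"
    unfolding e_def by blast
qed

text \<open>At most half of the words of \<open>N\<close> are shorter than half of their density times \<open>n\<close>,
  because balls grow at least linearly.\<close>
lemma card_square_le_splits:
  assumes k: "k \<ge> 1"
  shows "(card (N \<inter> ball1 k n))\<^sup>2 * (n + 1)
    \<le> 4 * ball_size k n * (\<Sum>w\<in>N \<inter> ball1 k n. length w + 1)"
proof -
  let ?A = "card (N \<inter> ball1 k n)" and ?b = "ball_size k n"
  define M where "M = {w \<in> N \<inter> ball1 k n. 2 * ?b * (length w + 1) \<le> ?A * (n + 1)}"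
  have finM: "finite M" unfolding M_def by (simp add: finite_ball1)
  have M: "2 * card M \<le> ?A"
  proof (cases "M = {}")
    case False
    define m where "m = Max (length ` M)"
    have "m \<in> length ` M" unfolding m_def using False finM by (intro Max_in) auto
    then have m: "2 * ?b * (m + 1) \<le> ?A * (n + 1)" "m \<le> n" by (auto simp: M_def ball1_def)
    have "M \<subseteq> ball1 k m"
      using finM by (auto simp: m_def M_def ball1_def)
    then have "card M \<le> ball_size k m"
      unfolding ball_size_def by (intro card_mono finite_ball1)
    then have "card M * (n + 1) \<le> ball_size k m * (n + 1)" by (rule mult_le_mono1)
    also have "\<dots> \<le> ?b * (m + 1)" by (rule ball_size_linear_growth[OF k m(2)])
    finally have "(2 * card M) * (n + 1) \<le> ?A * (n + 1)" using m(1) by linarith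
    then show ?thesis by (subst (asm) mult_le_cancel2) simp
  qed simp
  \<comment> \<open>At least half of the words remain, and each has length plus one above
    \<open>?A * (n + 1) / (2 * ?b)\<close>; this produces the square of \<open>?A\<close>.\<close>
  have "?A \<le> 2 * card (N \<inter> ball1 k n - M)"
    using M finM by (subst card_Diff_subset) (auto, auto simp: M_def)
  then have "?A * (?A * (n + 1)) \<le> 2 * card (N \<inter> ball1 k n - M) * (?A * (n + 1))"
    by (rule mult_le_mono1)
  also have "\<dots> = 2 * (\<Sum>w\<in>N \<inter> ball1 k n - M. ?A * (n + 1))" by simp
  also have "\<dots> \<le> 2 * (\<Sum>w\<in>N \<inter> ball1 k n - M. 2 * ?b * (length w + 1))"
    by (intro mult_le_mono2 sum_mono) (auto simp: M_def)
  also have "\<dots> \<le> 2 * (\<Sum>w\<in>N \<inter> ball1 k n. 2 * ?b * (length w + 1))"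
    by (intro mult_le_mono2 sum_mono2) (auto simp: finite_ball1)
  also have "\<dots> = 4 * ?b * (\<Sum>w\<in>N \<inter> ball1 k n. length w + 1)"
    by (simp add: sum_distrib_left mult.assoc)
  finally show ?thesis by (simp add: power2_eq_square algebra_simps)
qed

section \<open>Densities of a set and of its preimage\<close>

definition density1 :: "nat \<Rightarrow> word set \<Rightarrow> nat \<Rightarrow> real" where
  "density1 k N n = real (card (N \<inter> ball1 k n)) / real (card (ball1 k n))"

definition density2 :: "nat \<Rightarrow> (word \<times> word) set \<Rightarrow> nat \<Rightarrow> real" where
  "density2 k T n = real (card (T \<inter> ball2 k n)) / real (card (ball2 k n))"

lemma density_nonneg: "density1 k N n \<ge> 0" "density2 k T n \<ge> 0"
  by (simp_all add: density1_def density2_def)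

lemma negligible_density:
  "negligible1 k N \<longleftrightarrow> density1 k N \<longlonglongrightarrow> 0"
  "negligible2 k T \<longleftrightarrow> density2 k T \<longlonglongrightarrow> 0"
  by (simp_all add: negligible1_def negligible2_def density1_def[abs_def] density2_def[abs_def])

text \<open>Up to constants, one factor of the square counts words and the other their typical
  number of splittings. The 8 is the 4 of \<open>card_square_le_splits\<close> times the 2 of
  \<open>card_ball2_upper\<close>.\<close>

lemma density1_square_le:
  assumes k: "k \<ge> 1"
  shows "(density1 k N n)\<^sup>2 \<le> 8 * density2 k (quotient_pairs k N) n"
proof -
  define A b P B where "A = real (card (N \<inter> ball1 k n))" and "b = real (ball_size k n)"
    and "P = real (card (quotient_pairs k N \<inter> ball2 k n))" and "B = real (card (ball2 k n))"
  have "(card (N \<inter> ball1 k n))\<^sup>2 * (n + 1)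
      \<le> 4 * ball_size k n * card (quotient_pairs k N \<inter> ball2 k n)"
    using card_square_le_splits[OF k, of N n] splits_le_quotient_pairs[of N k n]
    by (meson le_trans mult_le_mono2)
  then have "real ((card (N \<inter> ball1 k n))\<^sup>2 * (n + 1))
      \<le> real (4 * ball_size k n * card (quotient_pairs k N \<inter> ball2 k n))"
    by (rule of_nat_mono)
  then have 1: "A\<^sup>2 * (n + 1) \<le> 4 * b * P" by (simp add: A_def b_def P_def algebra_simps)
  have b: "b > 0" using ball_size_pos by (simp add: b_def)
  have "real (card (ball2 k n)) \<le> real (2 * (n + 1) * ball_size k n)"
    by (intro of_nat_mono card_ball2_upper)
  then have 2: "B \<le> 2 * (n + 1) * b" by (simp add: B_def b_def algebra_simps)
  have "real ((n + 2) * ball_size k n) \<le> real (2 * card (ball2 k n))"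
    by (intro of_nat_mono card_ball2_lower k)
  moreover have "(n + 2) * ball_size k n > 0" using ball_size_pos[of k n] by simp
  ultimately have B: "B > 0" unfolding B_def by linarith
  have P: "P \<ge> 0" by (simp add: P_def)
  have "A\<^sup>2 / b\<^sup>2 \<le> 8 * P / (2 * (n + 1) * b)"
    using 1 b by (simp add: divide_simps power2_eq_square) (simp add: algebra_simps)
  also have "\<dots> \<le> 8 * P / B"
    using 2 B P by (intro divide_left_mono) auto
  finally show ?thesis
    by (simp add: density1_def density2_def A_def b_def P_def B_def power_divide ball_size_def)
qed

text \<open>A bound on the number of pairs is normalised by the lower bound for
  \<open>ball2\<close>, which costs the factor 2.\<close>

lemma density2_le:
  assumes k: "k \<ge> 1"
    and P: "real (card (quotient_pairs k N \<inter> ball2 k n)) \<le> real (n + 2) * ball_size k n * d"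
  shows "density2 k (quotient_pairs k N) n \<le> 2 * d"
proof -
  have "real ((n + 2) * ball_size k n) \<le> real (2 * card (ball2 k n))"
    by (intro of_nat_mono card_ball2_lower k)
  then have B: "real (n + 2) * ball_size k n \<le> 2 * card (ball2 k n)" by (simp add: algebra_simps)
  have pos: "real (n + 2) * ball_size k n > 0" using ball_size_pos[of k n] by simp
  then have "d \<ge> 0" using P by (smt (verit) of_nat_0_le_iff zero_le_mult_iff)
  then have "real (card (quotient_pairs k N \<inter> ball2 k n)) \<le> 2 * card (ball2 k n) * d"
    using P B by (meson mult_right_mono order_trans)
  moreover have "real (card (ball2 k n)) > 0" using B pos by linarith
  ultimately show ?thesis by (simp add: density2_def field_simps)
qed

text \<open>Here the ball has only \<open>2 * n + 1\<close> elements, so its square is comparable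
  with the size of \<open>ball2\<close> and the bound by a product loses only a constant.\<close>

lemma density2_le_rank_1: "density2 1 (quotient_pairs 1 N) n \<le> 4 * density1 1 N n"
proof -
  have b: "ball_size 1 n = 2 * n + 1"
    by (induction n) (simp_all add: ball_size_Suc sphere_size_simps card_ball1)
  have "real (card (quotient_pairs 1 N \<inter> ball2 1 n)) \<le> real (card (N \<inter> ball1 1 n)) * ball_size 1 n"
    using quotient_pairs_le_product[of 1 N n] by (simp flip: of_nat_mult del: One_nat_def)
  also have "real (card (N \<inter> ball1 1 n)) = density1 1 N n * ball_size 1 n"
    using ball_size_pos[of 1 n] by (simp add: density1_def ball_size_def)
  also have "\<dots> \<le> density1 1 N n * (2 * (n + 2))"
    by (intro mult_left_mono) (simp_all add: b[unfolded One_nat_def] density_nonneg)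
  finally have "real (card (quotient_pairs 1 N \<inter> ball2 1 n))
      \<le> real (n + 2) * ball_size 1 n * (2 * density1 1 N n)"
    by (simp add: mult_right_mono algebra_simps)
  from density2_le[OF _ this] show ?thesis by simp
qed

lemma ball_size_exponential:
  assumes "k \<ge> 2"
  shows "(2 * k - 1) ^ n \<le> ball_size k n" "ball_size k n \<le> 2 * (2 * k - 1) ^ n"
proof -
  \<comment> \<open>This turns the truncated \<open>2 * k - 1\<close> into
    \<open>j + 3\<close>.\<close>
  obtain j where k: "2 * k = j + 4" using assms by (metis add.commute le_Suc_ex mult_2 
    mult_le_mono2 numeral_Bit0)
  show "(2 * k - 1) ^ n \<le> ball_size k n"
  proof (cases n)
    case (Suc m)
    have "(2 * k - 1) ^ n \<le> sphere_size k n" by (simp add: Suc sphere_size_simps k)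
    then show ?thesis using Suc by (simp add: ball_size_Suc)
  qed (simp add: card_ball1 sphere_size_simps)
  show "ball_size k n \<le> 2 * (2 * k - 1) ^ n"
  proof (induction n)
    case (Suc n)
    have "2 * k - 1 = j + 3" and "sphere_size k (Suc n) = (j + 4) * (j + 3) ^ n"
      by (simp_all add: sphere_size_simps k add.commute)
    with Suc show ?case by (simp only: ball_size_Suc) (simp add: algebra_simps)
  qed (simp add: card_ball1 sphere_size_simps)
qed

text \<open>Raising \<open>j\<close> by 2 multiplies the left side by \<open>q\<close> and the right
  side by \<open>q * q * (4 / 9)\<close>, which is larger because \<open>q \<ge> 3\<close>.\<close>

lemma power_half_le:
  fixes q :: real assumes "q \<ge> 3"
  shows "q ^ (j div 2) \<le> q ^ j * (2 / 3) ^ j"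
proof (induction j rule: induct_nat_012)
  case (ge2 j)
  have "q ^ (Suc (Suc j) div 2) = q * q ^ (j div 2)" by simp
  also have "\<dots> \<le> q * (q ^ j * (2 / 3) ^ j)" using ge2 assms by simp
  also have "\<dots> \<le> (q * q * (4 / 9)) * (q ^ j * (2 / 3) ^ j)"
    using assms by (intro mult_right_mono) auto
  finally show ?case by simp
qed (use assms in auto)

text \<open>A word of length \<open>l\<close> has at most
  \<open>(l + 1) * ball_size k ((n - l) div 2)\<close> preimages in the ball of radius
  \<open>n\<close>. By exponential growth the last factor times \<open>ball_size k l\<close> is at
  most the fraction \<open>4 * (2 / 3) ^ (n - l)\<close> of \<open>ball_size k n\<close>.\<close>

lemma density2_le_convolution:
  assumes k: "k \<ge> 2"
  shows "density2 k (quotient_pairs k N) n \<le> 8 * (\<Sum>l\<le>n. density1 k N l * (2 / 3) ^ (n - l))"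
proof -
  let ?b = "\<lambda>n. real (ball_size k n)"
  define q where "q = real (2 * k - 1)"
  have q: "q \<ge> 3" using k by (simp add: q_def)
  have lower: "q ^ n \<le> ?b n" and upper: "?b n \<le> 2 * q ^ n" for n
    using ball_size_exponential[OF k, of n, THEN of_nat_mono, where 'a = real]
    unfolding q_def by (simp_all only: of_nat_power of_nat_mult of_nat_numeral)
  have summand: "?b l * ?b ((n - l) div 2) \<le> ?b n * (4 * (2 / 3) ^ (n - l))" if "l \<le> n" for l
  proof -
    have "?b l * ?b ((n - l) div 2) \<le> (2 * q ^ l) * (2 * q ^ ((n - l) div 2))"
      using q by (intro mult_mono upper) auto
    also have "\<dots> \<le> (2 * q ^ l) * (2 * (q ^ (n - l) * (2 / 3) ^ (n - l)))"
      using q by (intro mult_left_mono power_half_le) auto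
    also have "\<dots> = q ^ n * (4 * (2 / 3) ^ (n - l))"
      using that by (simp flip: power_add)
    also have "\<dots> \<le> ?b n * (4 * (2 / 3) ^ (n - l))"
      by (intro mult_right_mono lower) auto
    finally show ?thesis .
  qed
  have "card (quotient_pairs k N \<inter> ball2 k n)
      \<le> (\<Sum>l\<le>n. \<Sum>w\<in>N \<inter> sphere k l. (length w + 1) * ball_size k ((n - length w) div 2))"
    using quotient_pairs_le_fibres[of k N n] unfolding sum_over_ball .
  also have "\<dots> = (\<Sum>l\<le>n. card (N \<inter> sphere k l) * ((l + 1) * ball_size k ((n - l) div 2)))"
  proof (intro sum.cong refl)
    fix l
    have "(\<Sum>w\<in>N \<inter> sphere k l. (length w + 1) * ball_size k ((n - length w) div 2))
        = (\<Sum>w\<in>N \<inter> sphere k l. (l + 1) * ball_size k ((n - l) div 2))"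
      by (intro sum.cong) (auto simp: sphere_def)
    then show "(\<Sum>w\<in>N \<inter> sphere k l. (length w + 1) * ball_size k ((n - length w) div 2))
        = card (N \<inter> sphere k l) * ((l + 1) * ball_size k ((n - l) div 2))" by simp
  qed
  also have "\<dots> \<le> (\<Sum>l\<le>n. card (N \<inter> ball1 k l) * ((n + 2) * ball_size k ((n - l) div 2)))"
  proof (intro sum_mono mult_le_mono card_mono)
    show "N \<inter> sphere k l \<subseteq> N \<inter> ball1 k l" for l by (auto simp: sphere_def ball1_def)
  qed (simp_all add: finite_ball1)
  finally have "real (card (quotient_pairs k N \<inter> ball2 k n))
      \<le> (\<Sum>l\<le>n. real (card (N \<inter> ball1 k l)) * (real (n + 2) * ?b ((n - l) div 2)))"
    by (subst (asm) of_nat_le_iff[symmetric, where 'a = real]) (simp add: distrib_right)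
  also have "\<dots> = (\<Sum>l\<le>n. real (n + 2) * density1 k N l * (?b l * ?b ((n - l) div 2)))"
  proof (intro sum.cong refl)
    fix l
    have "real (card (N \<inter> ball1 k l)) = density1 k N l * ?b l"
      using ball_size_pos[of k l] by (simp add: density1_def ball_size_def)
    then show "real (card (N \<inter> ball1 k l)) * (real (n + 2) * ?b ((n - l) div 2))
        = real (n + 2) * density1 k N l * (?b l * ?b ((n - l) div 2))" by simp
  qed
  also have "\<dots> \<le> (\<Sum>l\<le>n. real (n + 2) * density1 k N l * (?b n * (4 * (2 / 3) ^ (n - l))))"
    by (intro sum_mono mult_left_mono summand) (auto simp: density_nonneg)
  also have "\<dots> = real (n + 2) * ?b n * (4 * (\<Sum>l\<le>n. density1 k N l * (2 / 3) ^ (n - l)))"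
    by (simp only: sum_distrib_left) (intro sum.cong refl, simp add: mult_ac)
  finally have "density2 k (quotient_pairs k N) n
      \<le> 2 * (4 * (\<Sum>l\<le>n. density1 k N l * (2 / 3) ^ (n - l)))"
    using k by (intro density2_le) auto
  then show ?thesis by simp
qed

text \<open>From pairs to words one estimate covers all positive ranks; conversely rank one, with
  linear growth, is separated from the ranks with exponential growth.\<close>

lemma negligible_quotient_pairs:
  "negligible2 k (quotient_pairs k N) \<longleftrightarrow> negligible1 k N"
proof (cases "k = 0")
  case True
  \<comment> \<open>Without generators the free group is trivial, so each ball is a single point and
    the two densities coincide.\<close>
  have "w \<in> FX 0 \<longleftrightarrow> w = []" for w by (cases w) (simp_all add: FX_Cons)
  then have FX0: "FX 0 = {[]}" by blast
  have ball1_0: "ball1 0 n = {[]}" for n by (auto simp: ball1_def FX0)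
  have ball2_0: "ball2 0 n = {([], [])}" for n by (auto simp: ball2_def FX0)
  have "([], []) \<in> quotient_pairs 0 N \<longleftrightarrow> [] \<in> N"
    by (simp add: quotient_pairs_def)
  then have "card (quotient_pairs 0 N \<inter> ball2 0 n) = card (N \<inter> ball1 0 n)"
    "card (ball2 0 n) = card (ball1 0 n)" for n
    by (simp_all add: ball1_0 ball2_0 Int_insert_right)
  then show ?thesis by (simp add: True negligible1_def negligible2_def)
next
  case False
  show ?thesis unfolding negligible_density
  proof
    assume "density2 k (quotient_pairs k N) \<longlonglongrightarrow> 0"
    then have "(\<lambda>n. 8 * density2 k (quotient_pairs k N) n) \<longlonglongrightarrow> 8 * 0"
      by (intro tendsto_mult tendsto_const)
    then have lim: "(\<lambda>n. 8 * density2 k (quotient_pairs k N) n) \<longlonglongrightarrow> 0" by simp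
    have "(density1 k N n)\<^sup>2 \<le> 8 * density2 k (quotient_pairs k N) n" for n
      using False by (intro density1_square_le) simp
    then have "(\<lambda>n. (density1 k N n)\<^sup>2) \<longlonglongrightarrow> 0"
      by (intro tendsto_sandwich[OF _ _ tendsto_const lim]) (simp_all add: always_eventually)
    then show "density1 k N \<longlonglongrightarrow> 0"
      by simp
  next
    assume *: "density1 k N \<longlonglongrightarrow> 0"
    show "density2 k (quotient_pairs k N) \<longlonglongrightarrow> 0"
    proof (cases "k = 1")
      case True
      have "(\<lambda>n. 4 * density1 k N n) \<longlonglongrightarrow> 4 * 0"
        by (intro tendsto_mult tendsto_const *)
      then show ?thesis
        using density2_le_rank_1 unfolding True
        by (intro tendsto_sandwich[of "\<lambda>n. 0" "density2 1 (quotient_pairs 1 N)" _ "\<lambda>n. 4 * density1 1 N n"])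
          (auto intro!: always_eventually simp: density_nonneg)
    next
      case False
      with \<open>k \<noteq> 0\<close> have k: "k \<ge> 2" by simp
      have "(\<lambda>n. 8 * (\<Sum>l\<le>n. density1 k N l * (2 / 3) ^ (n - l))) \<longlonglongrightarrow> 8 * 0"
        by (intro tendsto_mult tendsto_const geometric_convolution_tendsto_0 *) simp_all
      then have lim: "(\<lambda>n. 8 * (\<Sum>l\<le>n. density1 k N l * (2 / 3) ^ (n - l))) \<longlonglongrightarrow> 0"
        by (simp only: mult_zero_right)
      show ?thesis
        by (rule tendsto_sandwich[OF _ _ tendsto_const lim])
          (simp_all add: always_eventually density_nonneg density2_le_convolution[OF k])
    qed
  qed
qed

lemma negligible2_subset:
  assumes "negligible2 k T'" "T \<subseteq> T'"
  shows "negligible2 k T"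
proof -
  have "density2 k T n \<le> density2 k T' n" for n
    unfolding density2_def using assms(2) finite_ball2[of k n]
    by (intro divide_right_mono of_nat_mono card_mono) auto
  then show ?thesis
    using assms(1) unfolding negligible_density
    by (intro tendsto_sandwich[of "\<lambda>n. 0" "density2 k T" _ "density2 k T'"])
      (auto intro!: always_eventually simp: density_nonneg)
qed

subsection \<open>Transfer of algorithms\<close>

definition letter_code :: "nat \<times> bool \<Rightarrow> nat" where
  "letter_code a = prod_encode (fst a, if snd a then 1 else 0)"

definition letter_codes :: "nat \<Rightarrow> nat set" where
  "letter_codes k = letter_code ` {a. fst a < k}"

definition inv_code :: "nat \<Rightarrow> nat" where
  "inv_code x = letter_code (linv (inv_into UNIV letter_code x))"

definition head_code :: "nat \<Rightarrow> nat" where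
  "head_code c = fst (prod_decode (c - 1))"

definition tail_code :: "nat \<Rightarrow> nat" where
  "tail_code c = snd (prod_decode (c - 1))"

text \<open>As in \<open>ldiv\<close>, the inverse of the letter coded by \<open>x\<close> is
  pushed, so cancellation means that the head is \<open>x\<close> itself. The test
  \<open>c \<noteq> 0\<close> matters because \<open>head_code 0 = 0\<close> is also the code of the
  letter \<open>(0, False)\<close>.\<close>

definition push_code :: "nat \<Rightarrow> nat \<Rightarrow> nat \<Rightarrow> nat" where
  "push_code k x c = (if x \<notin> letter_codes k then c
     else if c \<noteq> 0 \<and> head_code c = x then tail_code c else Suc (prod_encode (inv_code x, c)))"

text \<open>\<open>ldiv\<close> on codes, where entries of the first list that encode no letter are ignored.\<close>
definition ldiv_code :: "nat \<Rightarrow> nat \<Rightarrow> nat \<Rightarrow> nat" where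
  "ldiv_code k m c = fold (push_code k) (list_decode m) c"

lemma inj_letter_code: "inj letter_code"
  by (auto simp: inj_def letter_code_def split: if_splits)

lemma inv_code_letter_code [simp]: "inv_code (letter_code a) = letter_code (linv a)"
  by (simp add: inv_code_def inj_letter_code)

lemma code_eq: "code w = list_encode (map letter_code w)"
  unfolding code_def letter_code_def ..

lemma code_Nil [simp]: "code [] = 0"
  and code_Cons: "code (a # w) = Suc (prod_encode (letter_code a, code w))"
  by (simp_all add: code_eq)

lemma head_tail_list_encode [simp]:
  "head_code (Suc (prod_encode (x, c))) = x" "tail_code (Suc (prod_encode (x, c))) = c"
  by (simp_all add: head_code_def tail_code_def)

lemma tail_code_0 [simp]: "tail_code 0 = 0"
  by (simp add: tail_code_def prod_decode_def prod_decode_aux.simps)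

lemma push_code_letter_code:
  assumes "fst a < k"
  shows "push_code k (letter_code a) (code v) = code (push (linv a) v)"
proof -
  have "letter_code a \<in> letter_codes k" using assms by (simp add: letter_codes_def)
  then show ?thesis
    using inj_letter_code by (cases v) (auto simp: push_code_def code_Cons inj_eq)
qed

lemma fold_push_code:
  "\<forall>a\<in>set p. fst a < k \<Longrightarrow> fold (push_code k) (map letter_code p) (code v) = code (ldiv p v)"
  by (induction p arbitrary: v) (simp_all add: push_code_letter_code)

lemma ldiv_code_code:
  "\<forall>a\<in>set p. fst a < k \<Longrightarrow> ldiv_code k (code p) (code v) = code (ldiv p v)"
  by (simp add: ldiv_code_def fold_push_code code_eq[of p])

text \<open>Dropping the entries that encode no letter leaves a word \<open>p\<close>, not
  necessarily reduced. So in a search over all numbers every candidate acts like a word.\<close>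

lemma ldiv_code_word:
  obtains p where "\<forall>a\<in>set p. fst a < k" "\<And>v. ldiv_code k m (code v) = code (ldiv p v)"
proof -
  have "\<exists>p. (\<forall>a\<in>set p. fst a < k) \<and>
      (\<forall>c. fold (push_code k) xs c = fold (push_code k) (map letter_code p) c)" for xs
  proof (induction xs)
    case (Cons x xs)
    then obtain p where p: "\<forall>a\<in>set p. fst a < k"
      "\<And>c. fold (push_code k) xs c = fold (push_code k) (map letter_code p) c" by blast
    show ?case
    proof (cases "x \<in> letter_codes k")
      case True
      then obtain a where "x = letter_code a" "fst a < k" by (auto simp: letter_codes_def)
      with p show ?thesis by (intro exI[of _ "a # p"]) auto
    next
      case False
      with p show ?thesis by (intro exI[of _ p]) (simp add: push_code_def[of k x])
    qed
  qed (auto intro: exI[of _ "[]"])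
  then obtain p where "\<forall>a\<in>set p. fst a < k"
    "\<And>c. fold (push_code k) (list_decode m) c = fold (push_code k) (map letter_code p) c" by blast
  with that show ?thesis by (simp add: ldiv_code_def fold_push_code)
qed

text \<open>This permits the code itself to serve as the number of rounds of a loop over the
  list.\<close>

lemma length_le_list_encode: "length xs \<le> list_encode xs"
proof (induction xs)
  case (Cons x xs)
  with le_prod_encode_2[of "list_encode xs" x] show ?case by simp
qed simp

lemma tail_code_funpow: "(tail_code ^^ i) (list_encode xs) = list_encode (drop i xs)"
proof (induction i)
  case (Suc i)
  have "tail_code (list_encode ys) = list_encode (tl ys)" for ys by (cases ys) auto
  with Suc show ?case by (simp add: tl_drop drop_Suc)
qed simp

text \<open>Round \<open>i\<close> handles the head of the \<open>i\<close>-th tail; after the end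
  of the list the tail is 0 and nothing changes.\<close>

lemma ldiv_code_rec:
  "ldiv_code k m c = rec_nat c (\<lambda>i r. if (tail_code ^^ i) m = 0 then r
     else push_code k (head_code ((tail_code ^^ i) m)) r) m"
proof -
  define xs where "xs = list_decode m"
  have m: "m = list_encode xs" by (simp add: xs_def)
  let ?rec = "rec_nat c (\<lambda>i r. if (tail_code ^^ i) m = 0 then r
     else push_code k (head_code ((tail_code ^^ i) m)) r)"
  have "?rec t = fold (push_code k) (take t xs) c" for t
  proof (induction t)
    case (Suc t)
    show ?case
    proof (cases "t < length xs")
      case True
      then have "(tail_code ^^ t) m = Suc (prod_encode (xs ! t, list_encode (drop (Suc t) xs)))"
        by (simp add: m tail_code_funpow Cons_nth_drop_Suc[symmetric])
      with Suc True show ?thesis by (simp add: take_Suc_conv_app_nth)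
    next
      case False
      then have "(tail_code ^^ t) m = 0" by (simp add: m tail_code_funpow)
      with Suc False show ?thesis by simp
    qed
  qed simp
  then show ?thesis
    using length_le_list_encode[of xs] by (simp add: ldiv_code_def m)
qed

lemma computable_head_code: "computable n A \<Longrightarrow> computable n (\<lambda>xs. head_code (A xs))"
  and computable_tail_code: "computable n A \<Longrightarrow> computable n (\<lambda>xs. tail_code (A xs))"
  unfolding head_code_def tail_code_def by (intro computable_prod_decode computable_pred; simp)+

lemma computable_push_code:
  assumes "computable n A" "computable n B"
  shows "computable n (\<lambda>xs. push_code k (A xs) (B xs))"
proof -
  \<comment> \<open>One finite table holds both the membership test and the inverse letter: 0 means
    no letter code, and other entries are shifted by one.\<close>
  let ?I = "\<lambda>x. if x \<in> letter_codes k then Suc (inv_code x) else 0"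
  have "finite (letter_codes k)" by (simp add: letter_codes_def finite_letters)
  from computable_comp1[OF computable_finite_support[OF this] assms(1)]
  have I: "computable n (\<lambda>xs. ?I (A xs))" .
  have "computable n (\<lambda>xs. if ?I (A xs) = 0 then B xs
      else if B xs = 0 then Suc (prod_encode (?I (A xs) - 1, B xs))
      else if head_code (B xs) = A xs then tail_code (B xs)
      else Suc (prod_encode (?I (A xs) - 1, B xs)))"
    by (intro computable_if computable_if_eq I assms computable_Suc computable_prod_encode
        computable_pred computable_head_code computable_tail_code)
  then show ?thesis
    by (rule computable_cong) (auto simp: push_code_def)
qed

lemma computable_tail_funpow:
  assumes "computable n A" "computable n B"
  shows "computable n (\<lambda>xs. (tail_code ^^ A xs) (B xs))"
proof -
  have "computable n (\<lambda>xs. rec_nat (B xs) (\<lambda>i r. tail_code r) (A xs))"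
    by (intro computable_rec[where G = "\<lambda>i r xs. tail_code r"] assms computable_tail_code
        computable_nth) auto
  moreover have "rec_nat c (\<lambda>i r. tail_code r) i = (tail_code ^^ i) c" for i c
    by (induction i) auto
  ultimately show ?thesis by simp
qed

lemma computable_ldiv_code:
  assumes "computable n A" "computable n B"
  shows "computable n (\<lambda>xs. ldiv_code k (A xs) (B xs))"
  unfolding ldiv_code_rec
  by (rule computable_rec[where G = "\<lambda>i r xs. if (tail_code ^^ i) (A xs) = 0 then r
     else push_code k (head_code ((tail_code ^^ i) (A xs))) r"])
    (intro assms computable_if computable_push_code computable_head_code computable_tail_funpow
      computable_nth computable_drop2 | simp)+

section \<open>Composition and search with partial algorithms\<close>

lemma recf_compose:
  assumes "\<And>G. G \<in> set Gs \<Longrightarrow> computable n G"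
  obtains f' where "\<And>xs r. length xs = n \<Longrightarrow> eval f' xs r \<longleftrightarrow> eval f (map (\<lambda>G. G xs) Gs) r"
proof -
  have "\<forall>G\<in>set Gs. \<exists>h. \<forall>xs. length xs = n \<longrightarrow> eval h xs (G xs)"
    using assms unfolding computable_def by auto
  then obtain h where h: "\<And>G xs. G \<in> set Gs \<Longrightarrow> length xs = n \<Longrightarrow> eval (h G) xs (G xs)"
    by metis
  have "eval (Cnf f (map h Gs)) xs r \<longleftrightarrow> eval f (map (\<lambda>G. G xs) Gs) r" if len: "length xs = n" for xs r
  proof
    assume "eval (Cnf f (map h Gs)) xs r"
    then obtain ys where ys: "length ys = length Gs"
      "\<forall>i<length Gs. eval (h (Gs ! i)) xs (ys ! i)" "eval f ys r"
      by (auto elim!: eval_CnfE)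
    \<comment> \<open>Determinism forces the intermediate values, so the composite halts only where
      \<open>f\<close> does.\<close>
    have "ys = map (\<lambda>G. G xs) Gs"
      using ys(1,2) h[OF _ len] by (auto simp: list_eq_iff_nth_eq intro: eval_deterministic)
    with ys(3) show "eval f (map (\<lambda>G. G xs) Gs) r" by simp
  next
    assume "eval f (map (\<lambda>G. G xs) Gs) r"
    then show "eval (Cnf f (map h Gs)) xs r"
      by (intro eval.comp[of "map (\<lambda>G. G xs) Gs"]) (use h len in auto)
  qed
  with that show ?thesis by blast
qed

text \<open>\<open>\<Phi> n c\<close> is 0 while no answer is known and otherwise one more than the
  answer. \<open>Mnf\<close> finds the least index with an answer, and \<open>h\<close> reads it off
  there.\<close>

lemma unbounded_search:
  assumes "computable 2 (\<lambda>xs. \<Phi> (xs ! 0) (xs ! 1))"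
  shows "\<exists>f. (\<forall>c n. \<Phi> n c \<noteq> 0 \<longrightarrow> (\<exists>r. eval f [c] r)) \<and>
    (\<forall>c r. eval f [c] r \<longrightarrow> (\<exists>n. \<Phi> n c = Suc r))"
proof -
  have "computable 2 (\<lambda>xs. if \<Phi> (xs ! 0) (xs ! 1) = 0 then 1 else 0)"
    by (intro computable_if assms computable_const)
  then obtain t where "\<And>xs. length xs = 2 \<Longrightarrow> eval t xs (if \<Phi> (xs ! 0) (xs ! 1) = 0 then 1 else 0)"
    unfolding computable_def by blast
  from this[of "[_, _]"] have t: "eval t [n, c] (if \<Phi> n c = 0 then 1 else 0)" for n c by simp
  have "computable 2 (\<lambda>xs. \<Phi> (xs ! 0) (xs ! 1) - 1)"
    by (intro computable_pred assms)
  then obtain h where "\<And>xs. length xs = 2 \<Longrightarrow> eval h xs (\<Phi> (xs ! 0) (xs ! 1) - 1)"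
    unfolding computable_def by blast
  from this[of "[_, _]"] have h: "eval h [n, c] (\<Phi> n c - 1)" for n c by simp
  let ?f = "Cnf h [Mnf t, Idf 0]"
  show ?thesis
  proof (intro exI[of _ ?f] conjI allI impI)
    fix c n assume "\<Phi> n c \<noteq> 0"
    define l where "l = (LEAST n. \<Phi> n c \<noteq> 0)"
    have l: "\<Phi> l c \<noteq> 0" unfolding l_def using \<open>\<Phi> n c \<noteq> 0\<close> by (rule LeastI)
    have less: "\<Phi> m c = 0" if "m < l" for m
      using not_less_Least[of m "\<lambda>n. \<Phi> n c \<noteq> 0"] that by (simp add: l_def)
    have "eval (Mnf t) [c] l"
    proof (rule eval.mu)
      show "eval t [l, c] 0" using t[of l c] l by simp
      show "\<forall>m<l. \<exists>r. eval t [m, c] r \<and> r \<noteq> 0"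
        using t less by (metis zero_neq_one)
    qed
    moreover have "eval (Idf 0) [c] c" using eval.proj[of 0 "[c]"] by simp
    ultimately have "eval ?f [c] (\<Phi> l c - 1)"
      by (intro eval.comp[of "[l, c]"] h) (auto simp: less_Suc_eq)
    then show "\<exists>r. eval ?f [c] r" ..
  next
    fix c r assume "eval ?f [c] r"
    then obtain ys where ys: "length ys = 2" "\<forall>i<2. eval ([Mnf t, Idf 0] ! i) [c] (ys ! i)" "eval h ys r"
      by (elim eval_CnfE) (simp add: numeral_2_eq_2)
    then obtain n c' where n: "ys = [n, c']" by (auto simp: numeral_2_eq_2 length_Suc_conv)
    have "eval (Mnf t) [c] n" "eval (Idf 0) [c] c'"
      using ys(2) by (auto simp: n dest: spec[of _ 0] spec[of _ 1])
    then have c': "c' = c" and "eval t [n, c] 0" by (auto elim: eval_MnfE eval_IdfE)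
    then have "(if \<Phi> n c = 0 then 1 else 0) = (0 :: nat)" using t eval_deterministic by blast
    then have "\<Phi> n c \<noteq> 0" by (simp split: if_splits)
    moreover have "r = \<Phi> n c - 1" using ys(3) h eval_deterministic by (auto simp: n c')
    ultimately show "\<exists>n. \<Phi> n c = Suc r" by (intro exI[of _ n]) simp
  qed
qed

section \<open>Evaluation of words in the group, and the two reductions\<close>

context group
begin

context
  fixes g :: "nat \<Rightarrow> 'a" and k :: nat
  assumes g: "g ` {..<k} \<subseteq> carrier G"
begin

definition letter_val :: "nat \<times> bool \<Rightarrow> 'a" where
  "letter_val a = (if snd a then g (fst a) else inv (g (fst a)))"

lemma piG_Nil: "piG G g [] = \<one>"
  and piG_Cons: "piG G g (a # w) = letter_val a \<otimes> piG G g w"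
  by (simp_all add: piG_def letter_val_def)

lemma letter_val_closed: "fst a < k \<Longrightarrow> letter_val a \<in> carrier G"
  using g by (auto simp: letter_val_def)

lemma letter_val_linv: "fst a < k \<Longrightarrow> letter_val (linv a) = inv (letter_val a)"
  using g by (auto simp: letter_val_def linv_def)

lemma piG_closed: "\<forall>a\<in>set w. fst a < k \<Longrightarrow> piG G g w \<in> carrier G"
  by (induction w) (auto simp: piG_Nil piG_Cons letter_val_closed)

lemma push_letters: "fst a < k \<Longrightarrow> \<forall>b\<in>set w. fst b < k \<Longrightarrow> \<forall>b\<in>set (push a w). fst b < k"
  by (cases w) auto

lemma piG_push:
  assumes "fst a < k" "\<forall>b\<in>set w. fst b < k"
  shows "piG G g (push a w) = letter_val a \<otimes> piG G g w"
proof (cases "w = [] \<or> hd w \<noteq> linv a")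
  case True
  then show ?thesis by (simp add: push_noncancel piG_Cons)
next
  case False
  then obtain v where w: "w = linv a # v" by (cases w) auto
  then show ?thesis
    using assms by (simp add: piG_Cons letter_val_linv letter_val_closed piG_closed m_assoc[symmetric])
qed

lemma piG_ldiv:
  assumes "\<forall>a\<in>set u. fst a < k" "\<forall>a\<in>set v. fst a < k"
  shows "piG G g (ldiv u v) = inv (piG G g u) \<otimes> piG G g v"
  using assms
proof (induction u arbitrary: v)
  case Nil
  then show ?case by (simp add: piG_Nil piG_closed)
next
  case (Cons a u)
  then have "piG G g (ldiv (a # u) v) = inv (piG G g u) \<otimes> piG G g (push (linv a) v)"
    using push_letters[of "linv a" v] by (simp del: linv_eq_iff)
  also have "\<dots> = inv (piG G g u) \<otimes> (inv (letter_val a) \<otimes> piG G g v)"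
    using Cons.prems by (simp add: piG_push letter_val_linv)
  also have "\<dots> = inv (piG G g (a # u)) \<otimes> piG G g v"
    using Cons.prems by (simp add: piG_Cons inv_mult_group m_assoc letter_val_closed piG_closed)
  finally show ?case .
qed

lemma piG_ldiv_eq_one:
  assumes "\<forall>a\<in>set u. fst a < k" "\<forall>a\<in>set v. fst a < k"
  shows "piG G g (ldiv u v) = \<one> \<longleftrightarrow> piG G g u = piG G g v"
  using assms by (simp add: piG_ldiv piG_closed inv_solve_left' flip: r_one)
    (metis assms inv_closed inv_equality l_inv inv_inv piG_closed)

lemma piG_ldiv_eq:
  assumes "\<forall>a\<in>set p. fst a < k" "\<forall>a\<in>set v. fst a < k" "\<forall>a\<in>set w. fst a < k"
  shows "piG G g (ldiv p v) = piG G g (ldiv p w) \<longleftrightarrow> piG G g v = piG G g w"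
  using assms by (simp add: piG_ldiv piG_closed)

text \<open>The word algorithm is run on the quotient. It is trusted only on codes of words in
  \<open>FX k\<close>, so it matters that \<open>ldiv u v\<close> is reduced.\<close>

lemma WP_imp_EP:
  assumes "WP_solvable_on G g k S"
  shows "EP_solvable_on G g k (quotient_pairs k S)"
proof -
  obtain f where f1: "\<And>w. w \<in> S \<Longrightarrow> \<exists>r. eval f [code w] r"
    and f2: "\<And>w r. w \<in> FX k \<Longrightarrow> eval f [code w] r \<Longrightarrow> (r = 0 \<or> r = 1) \<and> (r = 1 \<longleftrightarrow> piG G g w = \<one>)"
    using assms unfolding WP_solvable_on_def by blast
  have "computable 2 (\<lambda>xs. ldiv_code k (xs ! 0) (xs ! 1))"
    by (intro computable_ldiv_code computable_nth) auto
  then obtain f' where f': "\<And>xs r. length xs = 2 \<Longrightarrow>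
      eval f' xs r \<longleftrightarrow> eval f (map (\<lambda>G. G xs) [\<lambda>xs. ldiv_code k (xs ! 0) (xs ! 1)]) r"
    using recf_compose[of "[\<lambda>xs. ldiv_code k (xs ! 0) (xs ! 1)]" 2 f] by auto
  have ev: "eval f' [code u, code v] r \<longleftrightarrow> eval f [code (ldiv u v)] r" if "u \<in> FX k" for u v r
    using f'[of "[code u, code v]" r] ldiv_code_code[OF FX_letters[OF that], of v] by simp
  show ?thesis unfolding EP_solvable_on_def
  proof (intro exI[of _ f'] conjI ballI allI impI, clarify)
    fix u v assume "(u, v) \<in> quotient_pairs k S"
    then show "\<exists>r. eval f' [code u, code v] r"
      using f1 by (auto simp: quotient_pairs_def ev)
  next
    fix u v r assume uv: "u \<in> FX k" "v \<in> FX k" and "eval f' [code u, code v] r"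
    then have "eval f [code (ldiv u v)] r" by (simp add: ev)
    from f2[OF ldiv_FX this] uv
    show "r = 0 \<or> r = 1" "r = 1 \<longleftrightarrow> piG G g u = piG G g v"
      by (auto simp: piG_ldiv_eq_one FX_letters)
  qed
qed

text \<open>Every pair with quotient \<open>w\<close> arises by letting a word act on \<open>([], w)\<close>, so the algorithm
  searches in parallel over all such words and all running times of the algorithm for equality.\<close>
lemma EP_imp_WP:
  assumes T: "T \<subseteq> {(u, v). u \<in> FX k \<and> v \<in> FX k}" and "EP_solvable_on G g k T"
  shows "WP_solvable_on G g k {ldiv u v | u v. (u, v) \<in> T}"
proof -
  obtain f where f1: "\<And>u v. (u, v) \<in> T \<Longrightarrow> \<exists>r. eval f [code u, code v] r"
    and f2: "\<And>u v r. u \<in> FX k \<Longrightarrow> v \<in> FX k \<Longrightarrow> eval f [code u, code v] r \<Longrightarrow>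
      (r = 0 \<or> r = 1) \<and> (r = 1 \<longleftrightarrow> piG G g u = piG G g v)"
    using assms(2) unfolding EP_solvable_on_def by blast
  obtain F where F: "stages 2 f F" using stages_exist by blast
  \<comment> \<open>An index packs a stage with the code of an acting word, which is applied to the
    empty word, whose code is 0, and to the word with code \<open>c\<close>.\<close>
  define \<Phi> where "\<Phi> n c = F [fst (prod_decode n), ldiv_code k (snd (prod_decode n)) 0,
      ldiv_code k (snd (prod_decode n)) c]" for n c
  have nil: "computables 2 0 (\<lambda>xs. [])" by (simp add: computables_def)
  have F3: "computable (Suc (Suc (Suc 0))) F" using stagesD(1)[OF F] by (simp add: numeral_2_eq_2)
  have "computable 2 (\<lambda>xs. \<Phi> (xs ! 0) (xs ! 1))"
    unfolding \<Phi>_def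
    by (intro computable_tuple[OF F3] computables_Cons nil computable_ldiv_code
        computable_prod_decode computable_const computable_nth) auto
  from unbounded_search[OF this] obtain f' where f'1: "\<And>c n. \<Phi> n c \<noteq> 0 \<Longrightarrow> \<exists>r. eval f' [c] r"
    and f'2: "\<And>c r. eval f' [c] r \<Longrightarrow> \<exists>n. \<Phi> n c = Suc r"
    by blast
  show ?thesis unfolding WP_solvable_on_def
  proof (intro exI[of _ f'] conjI ballI allI impI)
    fix w assume "w \<in> {ldiv u v | u v. (u, v) \<in> T}"
    then obtain u v where uv: "(u, v) \<in> T" "w = ldiv u v" by blast
    with T have FX: "u \<in> FX k" "v \<in> FX k" by auto
    obtain r where "eval f [code u, code v] r" using f1 uv(1) by blast
    then have "\<forall>\<^sub>F s in sequentially. F [s, code u, code v] = Suc r"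
      using stagesD(3)[OF F] by simp
    then obtain s where s: "F [s, code u, code v] = Suc r"
      by (auto simp: eventually_sequentially)
    \<comment> \<open>The word \<open>winv u\<close> takes \<open>([], w)\<close> to
      \<open>(u, v)\<close>, a pair on which the equality algorithm halts.\<close>
    have p: "\<forall>a\<in>set (winv u). fst a < k" using FX(1) by (intro FX_letters FX_winv)
    have "ldiv (winv u) [] = u" using ldiv_winv[of u "[]" k] FX(1) by simp
    then have "ldiv_code k (code (winv u)) 0 = code u"
      using ldiv_code_code[OF p, of "[]"] by simp
    moreover have "ldiv_code k (code (winv u)) (code w) = code v"
      using ldiv_code_code[OF p, of w] ldiv_winv_ldiv[OF FX(2) FX_letters[OF FX(1)]]
      by (simp add: uv(2))
    ultimately have "\<Phi> (prod_encode (s, code (winv u))) (code w) \<noteq> 0"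
      using s by (simp add: \<Phi>_def)
    then show "\<exists>r. eval f' [code w] r" by (rule f'1)
  next
    fix w r assume w: "w \<in> FX k" and "eval f' [code w] r"
    then obtain n where n: "\<Phi> n (code w) = Suc r" using f'2 by blast
    \<comment> \<open>Whatever index succeeded, it compared the images of \<open>[]\<close> and
      \<open>w\<close> under one word \<open>p\<close>; left multiplication in the group is
      injective, so this decides whether \<open>w\<close> is trivial.\<close>
    obtain p where p: "\<forall>a\<in>set p. fst a < k"
      "\<And>v. ldiv_code k (snd (prod_decode n)) (code v) = code (ldiv p v)"
      using ldiv_code_word by metis
    have "F (fst (prod_decode n) # [code (ldiv p []), code (ldiv p w)]) = Suc r"
      using n p(2)[of w] p(2)[of "[]"] by (simp add: \<Phi>_def)
    then have "eval f [code (ldiv p []), code (ldiv p w)] r"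
      using stagesD(2)[OF F] by simp
    from f2[OF ldiv_FX[OF FX_Nil p(1)] ldiv_FX[OF w p(1)] this]
    have "(r = 0 \<or> r = 1) \<and> (r = 1 \<longleftrightarrow> piG G g (ldiv p []) = piG G g (ldiv p w))" .
    moreover have "piG G g (ldiv p []) = piG G g (ldiv p w) \<longleftrightarrow> piG G g w = \<one>"
      using piG_ldiv_eq[OF p(1), of "[]" w] FX_letters[OF w] by (auto simp: piG_Nil)
    ultimately show "r = 0 \<or> r = 1" "r = 1 \<longleftrightarrow> piG G g w = \<one>" by auto
  qed
qed

end

end

section \<open>The two equivalences\<close>

theorem theorem3p2:
  fixes G :: "('a, 'b) monoid_scheme" and g :: "nat \<Rightarrow> 'a" and k :: nat
  assumes "group G"
    and "g ` {..<k} \<subseteq> carrier G"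
    and "inj_on g {..<k}"
    and "generate G (g ` {..<k}) = carrier G"
  shows "(generic_WP G g k \<longleftrightarrow> generic_EP G g k) \<and>
         (WP_only_negligible G g k \<longleftrightarrow> EP_only_negligible G g k)"
proof -
  let ?pairs = "{(u, v). u \<in> FX k \<and> v \<in> FX k}"
  let ?quot = "\<lambda>T. {ldiv u v | u v. (u, v) \<in> T}"
  note WE = group.WP_imp_EP[OF assms(1,2)] and EW = group.EP_imp_WP[OF assms(1,2)]
  have FX: "ldiv u v \<in> FX k" if "u \<in> FX k" "v \<in> FX k" for u v
    using that by (intro ldiv_FX FX_letters)
  \<comment> \<open>A set \<open>T\<close> need not be a union of fibres, so it is related to the
    preimage of its quotients by inclusions only.\<close>
  have quot_FX: "?quot T \<subseteq> FX k" and pairs_quot: "T \<subseteq> quotient_pairs k (?quot T)"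
    and compl_quot: "quotient_pairs k (FX k - ?quot T) \<subseteq> ?pairs - T" if "T \<subseteq> ?pairs" for T
    using that FX by (auto simp: quotient_pairs_def)
  have pairs: "quotient_pairs k S \<subseteq> ?pairs" for S
    by (auto simp: quotient_pairs_def)
  have compl: "?pairs - quotient_pairs k S = quotient_pairs k (FX k - S)" for S
    using FX by (auto simp: quotient_pairs_def)
  have "generic_EP G g k" if "generic_WP G g k"
  proof -
    from that obtain S where S: "generic1 k S" "WP_solvable_on G g k S"
      by (auto simp: generic_WP_def)
    then have "generic2 k (quotient_pairs k S)"
      unfolding generic1_def generic2_def compl negligible_quotient_pairs by blast
    with WE[OF S(2)] pairs show ?thesis unfolding generic_EP_def by blast
  qed
  moreover have "generic_WP G g k" if "generic_EP G g k"
  proof -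
    from that obtain T where T: "T \<subseteq> ?pairs" "generic2 k T" "EP_solvable_on G g k T"
      unfolding generic_EP_def by blast
    \<comment> \<open>A word outside the quotients of \<open>T\<close> has its whole fibre outside
      \<open>T\<close>.\<close>
    have "negligible2 k (quotient_pairs k (FX k - ?quot T))"
      by (rule negligible2_subset[OF T(2)[unfolded generic2_def] compl_quot[OF T(1)]])
    then have "generic1 k (?quot T)"
      unfolding generic1_def negligible_quotient_pairs .
    with EW[OF T(1,3)] quot_FX[OF T(1)] show ?thesis unfolding generic_WP_def by blast
  qed
  moreover have "EP_only_negligible G g k" if W: "WP_only_negligible G g k"
    unfolding EP_only_negligible_def
  proof (intro allI impI)
    fix T assume T: "T \<subseteq> ?pairs" "EP_solvable_on G g k T"
    then have "negligible1 k (?quot T)"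
      using W EW[OF T] quot_FX[OF T(1)] unfolding WP_only_negligible_def by blast
    then show "negligible2 k T"
      using negligible2_subset[OF _ pairs_quot[OF T(1)]] by (simp add: negligible_quotient_pairs)
  qed
  moreover have "WP_only_negligible G g k" if E: "EP_only_negligible G g k"
    unfolding WP_only_negligible_def
  proof (intro allI impI)
    fix S assume "S \<subseteq> FX k" "WP_solvable_on G g k S"
    then have "negligible2 k (quotient_pairs k S)"
      using E WE pairs unfolding EP_only_negligible_def by blast
    then show "negligible1 k S" by (simp add: negligible_quotient_pairs)
  qed
  ultimately show ?thesis by blast
qed

end
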